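(* Let $H$ be a complex separable Hilbert space and let $P,Q$ be two invertible positive operators in $\mathfrak{B}(H)$ such that $\sigma(Q)\subset\sigma(P)$ or $\sigma(P)\subset\sigma(Q)$. Then the two following properties are equivalent: (i) $\forall X\in\mathfrak{B}(H),\ \|PXP^{-1}\|+\|Q^{-1}XQ\|\geq 2\|X\|$; (ii) $P=Q$.
   Context: $\mathfrak{B}(H)$ denotes the C*-algebra of all bounded linear operators on $H$ with the operator norm; $\sigma(A)$ denotes the spectrum of $A\in\mathfrak{B}(H)$. *)

theory Defs
  imports "HOL-Analysis.Analysis"
begin

text \<open>
  Complex Hilbert spaces. The real vector space, norm and topology are those of the library
  class \<^class>\<open>banach\<close>; the complex structure is required to be compatible with them. The inner
  product is linear in the first argument and conjugate linear in the second.
\<close>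

class complex_hilbert_space = banach +
  fixes scaleC :: "complex \<Rightarrow> 'a \<Rightarrow> 'a"  (infixr \<open>*\<^sub>C\<close> 75)
    and cinner :: "'a \<Rightarrow> 'a \<Rightarrow> complex"
  assumes scaleR_scaleC: "scaleR r x = complex_of_real r *\<^sub>C x"
    and scaleC_add_right: "a *\<^sub>C (x + y) = a *\<^sub>C x + a *\<^sub>C y"
    and scaleC_add_left: "(a + b) *\<^sub>C x = a *\<^sub>C x + b *\<^sub>C x"
    and scaleC_scaleC: "a *\<^sub>C b *\<^sub>C x = (a * b) *\<^sub>C x"
    and scaleC_one: "1 *\<^sub>C x = x"
    and cinner_commute: "cinner x y = cnj (cinner y x)"
    and cinner_add_left: "cinner (x + y) z = cinner x z + cinner y z"
    and cinner_scaleC_left: "cinner (a *\<^sub>C x) y = a * cinner x y"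
    and cinner_self_norm: "cinner x x = complex_of_real ((norm x)\<^sup>2)"

instantiation complex :: complex_hilbert_space
begin

definition scaleC_complex :: "complex \<Rightarrow> complex \<Rightarrow> complex" where
  "scaleC_complex a x = a * x"

definition cinner_complex :: "complex \<Rightarrow> complex \<Rightarrow> complex" where
  "cinner_complex x y = x * cnj y"

instance
  by standard
    (simp_all add: scaleC_complex_def cinner_complex_def scaleR_conv_of_real algebra_simps
      flip: complex_norm_square)

end

text \<open>
  Elements of the algebra of bounded operators are represented by functions satisfying the
  predicate below; their operator norm is the library's \<^const>\<open>onorm\<close>.
\<close>

definition bounded_clinear :: "('a::complex_hilbert_space \<Rightarrow> 'a) \<Rightarrow> bool" where
  "bounded_clinear A \<longleftrightarrow> bounded_linear A \<and> (\<forall>c x. A (c *\<^sub>C x) = c *\<^sub>C A x)"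

text \<open>
  The inverse is itself required to be a bounded operator. It is then unique and equal to the
  library's function inverse \<^term>\<open>inv A\<close>.
\<close>

definition invertible_op :: "('a::complex_hilbert_space \<Rightarrow> 'a) \<Rightarrow> bool" where
  "invertible_op A \<longleftrightarrow>
    bounded_clinear A \<and> (\<exists>B. bounded_clinear B \<and> A \<circ> B = id \<and> B \<circ> A = id)"

lemma invertible_op_inv:
  assumes "invertible_op A"
  shows "bounded_clinear (inv A)" "A \<circ> inv A = id" "inv A \<circ> A = id"
proof -
  obtain B where B: "bounded_clinear B" "A \<circ> B = id" "B \<circ> A = id"
    using assms unfolding invertible_op_def by blast
  then have "inv A = B"
    by (metis inv_unique_comp)
  with B show "bounded_clinear (inv A)" "A \<circ> inv A = id" "inv A \<circ> A = id"
    by simp_all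
qed

definition op_spectrum :: "('a::complex_hilbert_space \<Rightarrow> 'a) \<Rightarrow> complex set" where
  "op_spectrum A = {c. \<not> invertible_op (\<lambda>x. A x - c *\<^sub>C x)}"

text \<open>Membership in \<open>\<real>\<^sub>\<ge>\<^sub>0\<close> says that the complex number is real and nonnegative.\<close>

definition positive_op :: "('a::complex_hilbert_space \<Rightarrow> 'a) \<Rightarrow> bool" where
  "positive_op A \<longleftrightarrow> bounded_clinear A \<and> (\<forall>x. cinner (A x) x \<in> \<real>\<^sub>\<ge>\<^sub>0)"

end

theory Submission
  imports Defs "HOL-Computational_Algebra.Polynomial"
begin

text \<open>
  The estimates use only the real inner product \<open>Re \<langle>x, y\<rangle>\<close>. Testing the inequality on rank-one operators gives
  \<open>\<parallel>P x\<parallel> \<parallel>P\<^sup>-\<^sup>1 y\<parallel> + \<parallel>Q\<^sup>-\<^sup>1 x\<parallel> \<parallel>Q y\<parallel> \<ge> 2 \<parallel>x\<parallel> \<parallel>y\<parallel>\<close>.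
  The choice \<open>x = Q z\<close>, \<open>y = P Q z\<close> shows that every approximate eigenvector of \<open>D = Q P Q\<close> is one of \<open>Q\<close>,
  with a linear bound on the error; cutting an arbitrary vector into approximate eigenvectors of \<open>D\<close> with
  Bernstein polynomials then shows that \<open>Q\<close> commutes with \<open>D\<close>, hence with \<open>P\<close>. For two points
  \<open>(p, q)\<close>, \<open>(p', q')\<close> of the joint approximate spectrum the rank-one inequality reads
  \<open>p / p' + q' / q \<ge> 2\<close>. By the inclusion of the spectra, a point \<open>(p, q)\<close> starts an infinite orbit of points
  \<open>(x\<^sub>n, x\<^sub>n\<^sub>+\<^sub>1)\<close> (or of reversed pairs), along which both \<open>x\<^sub>n\<close> and \<open>1 / x\<^sub>n\<close> are convex and bounded.
  So the orbit is constant and \<open>p = q\<close>, which gives \<open>P = Q\<close>.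

  Conversely, if \<open>P = Q\<close> then \<open>X\<^sup>* X\<close> is similar to a product of two operators of norms
  \<open>\<parallel>P\<^sup>-\<^sup>1 X P\<parallel>\<close> and \<open>\<parallel>P X P\<^sup>-\<^sup>1\<parallel>\<close>, which therefore bounds its spectral radius \<open>\<parallel>X\<parallel>\<^sup>2\<close>; conclude by AM--GM.
\<close>

subsection \<open>The real inner product\<close>

definition rip :: "'a::complex_hilbert_space \<Rightarrow> 'a \<Rightarrow> real" where
  "rip x y = Re (cinner x y)"

lemma rip_commute: "rip x y = rip y x"
  unfolding rip_def by (subst cinner_commute) simp

lemma rip_add_left: "rip (x + y) z = rip x z + rip y z"
  by (simp add: rip_def cinner_add_left)

lemma rip_scaleR_left: "rip (r *\<^sub>R x) y = r * rip x y"
  by (simp add: rip_def scaleR_scaleC cinner_scaleC_left)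

lemma rip_add_right: "rip z (x + y) = rip z x + rip z y"
  by (metis rip_add_left rip_commute)

lemma rip_scaleR_right: "rip y (r *\<^sub>R x) = r * rip y x"
  by (metis rip_scaleR_left rip_commute)

lemma rip_minus_left: "rip (- x) y = - rip x y"
  using rip_scaleR_left [of "-1" x y] by simp

lemma rip_minus_right: "rip x (- y) = - rip x y"
  by (metis rip_minus_left rip_commute)

lemma rip_diff_left: "rip (x - y) z = rip x z - rip y z"
  by (metis add_uminus_conv_diff rip_add_left rip_minus_left)

lemma rip_diff_right: "rip z (x - y) = rip z x - rip z y"
  by (metis rip_diff_left rip_commute)

lemma rip_zero_left [simp]: "rip 0 x = 0"
  using rip_scaleR_left [of 0 0 x] by simp

lemma rip_zero_right [simp]: "rip x 0 = 0"
  by (metis rip_zero_left rip_commute)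

lemma rip_sum_left: "rip (\<Sum>i\<in>I. f i) y = (\<Sum>i\<in>I. rip (f i) y)"
  by (induction I rule: infinite_finite_induct) (simp_all add: rip_add_left)

lemma rip_self: "rip x x = (norm x)\<^sup>2"
  by (simp add: rip_def cinner_self_norm)

lemmas rip_linear = rip_add_left rip_add_right rip_diff_left rip_diff_right
  rip_scaleR_left rip_scaleR_right rip_minus_left rip_minus_right

lemma norm_diff_sq: "(norm (x - y))\<^sup>2 = (norm x)\<^sup>2 - 2 * rip x y + (norm y)\<^sup>2"
  unfolding rip_self [symmetric] by (simp add: rip_linear rip_commute [of y x])

lemma norm_add_sq: "(norm (x + y))\<^sup>2 = (norm x)\<^sup>2 + 2 * rip x y + (norm y)\<^sup>2"
  unfolding rip_self [symmetric] by (simp add: rip_linear rip_commute [of y x])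

lemma norm_diff_scaleR_sq:
  "(norm (x - a *\<^sub>R y))\<^sup>2 = (norm x)\<^sup>2 - 2 * a * rip x y + a\<^sup>2 * (norm y)\<^sup>2"
  by (simp add: norm_diff_sq rip_linear power_mult_distrib)

lemma rip_Cauchy_Schwarz: "\<bar>rip x y\<bar> \<le> norm x * norm y"
proof (cases "y = 0")
  case False
  have "0 \<le> (norm ((norm y)\<^sup>2 *\<^sub>R x - rip x y *\<^sub>R y))\<^sup>2"
    by simp
  also have "\<dots> = (norm y)\<^sup>2 * ((norm x * norm y)\<^sup>2 - (rip x y)\<^sup>2)"
    unfolding norm_diff_scaleR_sq by (simp add: rip_linear) algebra
  finally have "(rip x y)\<^sup>2 \<le> (norm x * norm y)\<^sup>2"
    using False by (simp add: zero_le_mult_iff)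
  then show ?thesis
    by (simp add: abs_le_square_iff [symmetric])
qed simp

lemma rip_le_norms: "rip x y \<le> norm x * norm y"
  using rip_Cauchy_Schwarz [of x y] by linarith

text \<open>Self-adjointness for the real inner product. The arguments on polynomials of an operator
  are purely real-linear, so the complex structure is left out of them.\<close>

definition rsym :: "('a::complex_hilbert_space \<Rightarrow> 'a) \<Rightarrow> bool" where
  "rsym A \<longleftrightarrow> (\<forall>x y. rip (A x) y = rip x (A y))"

lemma rsymD: "rsym A \<Longrightarrow> rip (A x) y = rip x (A y)"
  by (simp add: rsym_def)

subsection \<open>Polynomials of an operator and Bernstein decompositions\<close>

text \<open>Horner's scheme for \<open>p(D) z\<close>. Evaluating at a vector keeps everything at
  the level of functions, without an algebra of operators.\<close>

definition peval :: "real poly \<Rightarrow> ('a::real_vector \<Rightarrow> 'a) \<Rightarrow> 'a \<Rightarrow> 'a" where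
  "peval p D z = fold_coeffs (\<lambda>a v. a *\<^sub>R z + D v) p 0"

lemma peval_0 [simp]: "peval 0 D z = 0"
  by (simp add: peval_def)

definition bern :: "nat \<Rightarrow> nat \<Rightarrow> real poly" where
  "bern n k = smult (real (n choose k)) ([:0, 1:] ^ k * [:1, -1:] ^ (n - k))"

lemma poly_bern: "poly (bern n k) x = Bernstein n k x"
  by (simp add: bern_def Bernstein_def)

lemma sum_bern: "(\<Sum>k\<le>n. bern n k) = 1"
  by (rule poly_ext) (simp add: poly_sum poly_bern)

text \<open>This is the variance \<open>x (1 - x) / n\<close> of a binomial frequency
  \<open>k / n\<close>: the Bernstein weights concentrate where \<open>k / n\<close> is close to
  \<open>x\<close>.\<close>

lemma sum_bern_second_moment:
  assumes "n > 0"
  shows "(\<Sum>k\<le>n. [:- (real k / real n), 1:]\<^sup>2 * bern n k) = smult (1 / real n) ([:0, 1:] * [:1, -1:])"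
proof (rule poly_ext)
  fix x :: real
  \<comment> \<open>The square is rewritten in terms of \<open>1\<close>, \<open>k\<close> and
    \<open>k (k - 1)\<close>, whose Bernstein sums are known.\<close>
  have *: "(x - k / n)\<^sup>2 * b = (n\<^sup>2 * x\<^sup>2 * b + (1 - 2 * n * x) * (k * b) + k * (k - 1) * b) / n\<^sup>2"
    if "n \<noteq> 0" for k n b :: real
    using that by (simp add: field_simps power2_eq_square)
  have "(\<Sum>k\<le>n. (x - real k / real n)\<^sup>2 * Bernstein n k x)
      = ((real n)\<^sup>2 * x\<^sup>2 * (\<Sum>k\<le>n. Bernstein n k x) + (1 - 2 * real n * x) * (\<Sum>k\<le>n. real k * Bernstein n k x)
         + (\<Sum>k\<le>n. real k * (real k - 1) * Bernstein n k x)) / (real n)\<^sup>2"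
    using assms by (simp only: * of_nat_0_less_iff order_less_imp_not_eq2 sum_divide_distrib [symmetric]
        sum.distrib sum_distrib_left [symmetric] not_False_eq_True of_nat_eq_0_iff mult.assoc)
  also have "\<dots> = x * (1 - x) / n"
    unfolding sum_Bernstein sum_k_Bernstein sum_kk_Bernstein
    using assms by (simp add: field_simps power2_eq_square)
  finally show "poly (\<Sum>k\<le>n. [:- (real k / real n), 1:]\<^sup>2 * bern n k) x
      = poly (smult (1 / real n) ([:0, 1:] * [:1, -1:])) x"
    by (simp add: poly_sum poly_bern poly_power right_diff_distrib diff_divide_distrib)
qed

lemma norm_sum_sq_le: "(norm (\<Sum>i\<in>I. f i))\<^sup>2 \<le> real (card I) * (\<Sum>i\<in>I. (norm (f i))\<^sup>2)"
proof -
  have "(norm (\<Sum>i\<in>I. f i))\<^sup>2 \<le> (\<Sum>i\<in>I. norm (f i))\<^sup>2"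
    by (intro power_mono norm_sum) simp
  also have "\<dots> \<le> (\<Sum>i\<in>I. (norm (f i))\<^sup>2) * card I"
    by (rule sum_squared_le_sum_of_squares)
  finally show ?thesis
    by (simp add: mult.commute)
qed

section \<open>Algebra of polynomials of an operator\<close>

lemma peval_pCons:
  assumes "bounded_linear D"
  shows "peval (pCons a p) D z = a *\<^sub>R z + D (peval p D z)"
proof (cases "a = 0 \<and> p = 0")
  case True
  then show ?thesis
    using linear_0 [OF bounded_linear.linear [OF assms]] by simp
next
  case False
  then show ?thesis
    by (auto simp: peval_def)
qed

lemma peval_add:
  assumes "bounded_linear D"
  shows "peval (p + q) D z = peval p D z + peval q D z"
proof (induction p arbitrary: q)
  case (pCons a p)
  interpret bounded_linear D by (rule assms)
  obtain b q' where "q = pCons b q'" by (cases q)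
  then show ?case
    by (simp add: peval_pCons [OF assms] pCons add algebra_simps)
qed simp

lemma peval_smult:
  assumes "bounded_linear D"
  shows "peval (smult c p) D z = c *\<^sub>R peval p D z"
proof (induction p)
  case (pCons a p)
  interpret bounded_linear D by (rule assms)
  show ?case
    by (simp add: peval_pCons [OF assms] pCons scaleR algebra_simps)
qed simp

lemma peval_mult:
  assumes "bounded_linear D"
  shows "peval (p * q) D z = peval p D (peval q D z)"
proof (induction p)
  case (pCons a p)
  interpret bounded_linear D by (rule assms)
  show ?case
    by (simp add: peval_pCons [OF assms] peval_add [OF assms] peval_smult [OF assms] pCons)
qed simp

lemma peval_1:
  assumes "bounded_linear D"
  shows "peval 1 D z = z"
  using linear_0 [OF bounded_linear.linear [OF assms]]
  by (simp add: peval_pCons [OF assms] one_pCons)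

lemma peval_linear_factor:
  assumes "bounded_linear D"
  shows "peval [:a, b:] D z = a *\<^sub>R z + b *\<^sub>R D z"
proof -
  interpret bounded_linear D by (rule assms)
  show ?thesis by (simp add: peval_pCons [OF assms] scaleR zero)
qed

lemma smult_sum_right: "smult c (\<Sum>i\<in>I. f i) = (\<Sum>i\<in>I. smult c (f i))"
  by (induction I rule: infinite_finite_induct) (simp_all add: smult_add_right)

lemma peval_sum:
  assumes "bounded_linear D"
  shows "peval (\<Sum>i\<in>I. f i) D z = (\<Sum>i\<in>I. peval (f i) D z)"
  by (induction I rule: infinite_finite_induct) (simp_all add: peval_add [OF assms])

lemma peval_commute:
  assumes "bounded_linear D" "bounded_linear T" "\<And>z. T (D z) = D (T z)"
  shows "T (peval p D z) = peval p D (T z)"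
proof (induction p)
  case 0
  interpret T: bounded_linear T by fact
  show ?case by (simp add: T.zero)
next
  case (pCons a p)
  interpret T: bounded_linear T by fact
  show ?case
    by (simp add: peval_pCons [OF assms(1)] T.add T.scaleR assms(3) pCons)
qed

lemma rsym_peval:
  assumes "bounded_linear D" "rsym D"
  shows "rip (peval p D x) y = rip x (peval p D y)"
proof (induction p arbitrary: x y)
  case (pCons a p)
  have "D (peval p D y) = peval p D (D y)"
    by (rule peval_commute) (use assms in auto)
  then show ?case
    by (simp add: peval_pCons [OF assms(1)] rip_linear rsymD [OF assms(2)] pCons)
qed simp

section \<open>Positivity of polynomials of an operator between \<open>0\<close> and the
  identity\<close>

context
  fixes D :: "'a::complex_hilbert_space \<Rightarrow> 'a"
  assumes lin: "bounded_linear D" and sym: "rsym D"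
    and ge0: "\<And>x. 0 \<le> rip (D x) x" and le1: "\<And>x. rip (D x) x \<le> (norm x)\<^sup>2"
begin

text \<open>Positivity of the quadratic form of \<open>p(D)\<close>, not of \<open>p\<close> on the
  unit interval. It is propagated by algebraic identities alone, which avoids square roots of
  operators and functional calculus.\<close>

definition pos_poly :: "real poly \<Rightarrow> bool" where
  "pos_poly p \<longleftrightarrow> (\<forall>z. 0 \<le> rip (peval p D z) z)"

text \<open>\<open>q(D)\<close> is symmetric, so one factor moves across the inner product and the
  form of \<open>p(D)\<close> is taken at \<open>q(D) z\<close>.\<close>

lemma pos_poly_square: "pos_poly p \<Longrightarrow> pos_poly (q\<^sup>2 * p)"
  unfolding pos_poly_def
proof
  fix z
  assume "\<forall>z. 0 \<le> rip (peval p D z) z"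
  moreover have "peval (q\<^sup>2 * p) D z = peval q D (peval p D (peval q D z))"
    by (simp add: power2_eq_square peval_mult [OF lin, symmetric] mult_ac)
  ultimately show "0 \<le> rip (peval (q\<^sup>2 * p) D z) z"
    using rsym_peval [OF lin sym, of q _ z] by simp
qed

lemma pos_poly_1: "pos_poly 1"
  by (simp add: pos_poly_def peval_1 [OF lin] rip_self)

lemma pos_poly_add: "pos_poly p \<Longrightarrow> pos_poly q \<Longrightarrow> pos_poly (p + q)"
  by (simp add: pos_poly_def peval_add [OF lin] rip_linear)

lemma pos_poly_smult: "c \<ge> 0 \<Longrightarrow> pos_poly p \<Longrightarrow> pos_poly (smult c p)"
  by (simp add: pos_poly_def peval_smult [OF lin] rip_linear)

lemma pos_poly_sum: "(\<And>i. i \<in> I \<Longrightarrow> pos_poly (f i)) \<Longrightarrow> pos_poly (\<Sum>i\<in>I. f i)"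
  by (induction I rule: infinite_finite_induct)
    (auto intro: pos_poly_add simp: pos_poly_def [of 0])

lemma pos_poly_factors:
  "pos_poly [:0, 1:]" "pos_poly [:1, -1:]" "pos_poly ([:0, 1:] * [:1, -1:])"
proof -
  show 1: "pos_poly [:0, 1:]" and 2: "pos_poly [:1, -1:]"
    using ge0 le1 by (simp_all add: pos_poly_def peval_linear_factor [OF lin] rip_linear rip_self)
  \<comment> \<open>The identity \<open>x (1 - x) = x^2 (1 - x) + (1 - x)^2 x\<close> expresses the
    product through squares times positive factors.\<close>
  have "[:0, 1:] * [:1, -1:] = [:0, 1:]\<^sup>2 * [:1, -1:] + [:1, -1:]\<^sup>2 * [:0, 1::real:]"
    by (simp add: power2_eq_square)
  then show "pos_poly ([:0, 1:] * [:1, -1:])"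
    using 1 2 pos_poly_add pos_poly_square by metis
qed

text \<open>Splitting off the even part of both exponents as a square leaves one of the four
  products \<open>1\<close>, \<open>x\<close>, \<open>1 - x\<close>,
  \<open>x (1 - x)\<close>.\<close>

lemma pos_poly_powers: "pos_poly ([:0, 1:] ^ a * [:1, -1:] ^ b)"
proof -
  define s t where "s = [:0, 1::real:]" "t = [:1, -1::real:]"
  have "pos_poly (s ^ (a mod 2) * t ^ (b mod 2))"
    using pos_poly_factors pos_poly_1
    by (cases "even a"; cases "even b") (simp_all add: s_t_def odd_iff_mod_2_eq_one even_iff_mod_2_eq_zero)
  then have "pos_poly ((s ^ (a div 2) * t ^ (b div 2))\<^sup>2 * (s ^ (a mod 2) * t ^ (b mod 2)))"
    by (rule pos_poly_square)
  moreover have "(s ^ c * t ^ d)\<^sup>2 * (s ^ e * t ^ f) = s ^ (2 * c + e) * t ^ (2 * d + f)" for c d e f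
    by (simp add: power_add power_mult_distrib power_mult [symmetric] mult_ac)
  ultimately show ?thesis
    by (simp add: s_t_def)
qed

lemma pos_poly_bern_mult: "pos_poly (bern n k * bern m l)" "pos_poly (bern n k)"
proof -
  have "bern n k * bern m l = smult (real (n choose k) * real (m choose l))
      ([:0, 1:] ^ (k + l) * [:1, -1:] ^ ((n - k) + (m - l)))"
    by (simp add: bern_def power_add mult_ac)
  then show "pos_poly (bern n k * bern m l)"
    by (metis pos_poly_powers pos_poly_smult mult_nonneg_nonneg of_nat_0_le_iff)
  show "pos_poly (bern n k)"
    unfolding bern_def by (intro pos_poly_smult pos_poly_powers) simp
qed

lemma norm_peval_sq: "(norm (peval p D z))\<^sup>2 = rip (peval (p\<^sup>2) D z) z"
  using rsym_peval [OF lin sym, of p "peval p D z" z]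
  by (simp add: power2_eq_square [of p] peval_mult [OF lin] flip: rip_self)

text \<open>
  The Bernstein polynomials of degree \<open>N\<^sup>2\<close> are grouped into \<open>N + 1\<close> blocks, so that the total
  squared error \<open>4 / N\<^sup>2\<close> is of smaller order than the reciprocal of the number of pieces.
\<close>

lemma approximate_spectral_decomposition:
  assumes "N > 0"
  shows "\<exists>\<phi> :: nat \<Rightarrow> real poly. \<forall>z. (\<Sum>i\<le>N. peval (\<phi> i) D z) = z
    \<and> (\<Sum>i\<le>N. (norm (peval (\<phi> i) D z))\<^sup>2) \<le> (norm z)\<^sup>2
    \<and> (\<Sum>i\<le>N. (norm (D (peval (\<phi> i) D z) - (real i / real N) *\<^sub>R peval (\<phi> i) D z))\<^sup>2)
       \<le> 4 / (real N)\<^sup>2 * (norm z)\<^sup>2"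
proof -
  define n where "n = N\<^sup>2"
  \<comment> \<open>Since \<open>k\<close> runs up to \<open>n = N^2\<close> inclusive, block
    \<open>N\<close> consists of \<open>k = n\<close> alone; hence \<open>N + 1\<close> blocks
    instead of \<open>N\<close>.\<close>
  define G where "G i = {k. k \<le> n \<and> k div N = i}" for i
  define \<phi> where "\<phi> i = (\<Sum>k\<in>G i. bern n k)" for i
  have n0: "n > 0"
    using assms by (simp add: n_def)
  have le: "k div N \<le> N" if "k \<le> n" for k
    using that div_le_mono [of k n N] assms by (simp add: n_def power2_eq_square)
  have regroup: "(\<Sum>i\<le>N. \<Sum>k\<in>G i. f i k) = (\<Sum>k\<le>n. f (k div N) k)" for f :: "nat \<Rightarrow> nat \<Rightarrow> real poly"
  proof -
    have "(\<Sum>k\<le>n. f (k div N) k) = (\<Sum>i\<le>N. \<Sum>k\<in>{k \<in> {..n}. k div N = i}. f (k div N) k)"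
      by (rule sum.group [symmetric]) (use le in auto)
    also have "\<dots> = (\<Sum>i\<le>N. \<Sum>k\<in>G i. f i k)"
      by (intro sum.cong) (auto simp: G_def)
    finally show ?thesis ..
  qed
  have one: "(\<Sum>i\<le>N. \<phi> i) = 1"
    unfolding \<phi>_def regroup sum_bern ..
  \<comment> \<open>As \<open>1 - \<phi> i\<close> is the sum of the other pieces, this is a sum of
    products of Bernstein polynomials. It says that the square of \<open>\<phi> i\<close> lies below
    \<open>\<phi> i\<close> as a form.\<close>
  have pos2: "pos_poly (\<phi> i * (1 - \<phi> i))" if "i \<le> N" for i
  proof -
    have "1 - \<phi> i = (\<Sum>j\<in>{..N} - {i}. \<phi> j)"
      using that one by (simp add: sum_diff1)
    then have "\<phi> i * (1 - \<phi> i) = (\<Sum>j\<in>{..N} - {i}. \<phi> i * \<phi> j)"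
      by (simp add: sum_distrib_left)
    moreover have "pos_poly (\<phi> i * \<phi> j)" for j
      unfolding \<phi>_def sum_product by (intro pos_poly_sum pos_poly_bern_mult)
    ultimately show ?thesis
      by (simp add: pos_poly_sum)
  qed
  have sq_le: "rip (peval (q\<^sup>2 * (\<phi> i)\<^sup>2) D z) z \<le> rip (peval (q\<^sup>2 * \<phi> i) D z) z" if "i \<le> N" for i q z
  proof -
    have "q\<^sup>2 * \<phi> i = q\<^sup>2 * (\<phi> i)\<^sup>2 + q\<^sup>2 * (\<phi> i * (1 - \<phi> i))"
      by (simp add: algebra_simps power2_eq_square)
    then show ?thesis
      using pos_poly_square [OF pos2 [OF that], of q]
      by (simp add: pos_poly_def peval_add [OF lin] rip_linear)
  qed
  show ?thesis
  proof (intro exI [of _ \<phi>] allI conjI)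
    show "(\<Sum>i\<le>N. peval (\<phi> i) D z) = z" for z
      using one by (simp add: peval_sum [OF lin, symmetric] peval_1 [OF lin])
    show "(\<Sum>i\<le>N. (norm (peval (\<phi> i) D z))\<^sup>2) \<le> (norm z)\<^sup>2" for z
    proof -
      have "(\<Sum>i\<le>N. (norm (peval (\<phi> i) D z))\<^sup>2) \<le> (\<Sum>i\<le>N. rip (peval (\<phi> i) D z) z)"
        using sq_le [of _ 1 z] by (intro sum_mono) (simp add: norm_peval_sq)
      also have "\<dots> = (norm z)\<^sup>2"
        using one by (simp add: rip_sum_left [symmetric] peval_sum [OF lin, symmetric] peval_1 [OF lin] rip_self)
      finally show ?thesis .
    qed
    fix z
    define d where "d i = real i / real N" for i
    define s where "s c = [:- c, 1::real:]" for c
    \<comment> \<open>Moves the centre from \<open>k / n\<close>, where the variance is known, to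
      the block value \<open>d i\<close>; the two differ by at most \<open>1 / N\<close> inside a
      block.\<close>
    have split: "rip (peval ((s (d i))\<^sup>2 * bern n k) D z) z
        \<le> 2 * rip (peval ((s (k / n))\<^sup>2 * bern n k) D z) z
          + 2 / (real N)\<^sup>2 * rip (peval (bern n k) D z) z" if "k \<in> G i" for i k
    proof -
      have ki: "N * i \<le> k" "k \<le> N * i + N"
        using that assms
         apply (auto simp: G_def)
        by (metis add.commute div_mult_mod_eq less_imp_le mod_less_divisor mult.commute nat_add_left_cancel_le)
      have "\<bar>real k - real N * real i\<bar> \<le> real N"
        using ki unfolding of_nat_mult [symmetric] by linarith
      then have "(real k - real N * real i)\<^sup>2 \<le> (real N)\<^sup>2"
        by (metis abs_ge_zero power2_abs power_mono)
      moreover have "(k / n - d i)\<^sup>2 = (real k - real N * real i)\<^sup>2 / (real n)\<^sup>2"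
        using assms by (simp add: d_def n_def power2_eq_square field_simps)
      ultimately have "(k / n - d i)\<^sup>2 \<le> (real N)\<^sup>2 / (real n)\<^sup>2"
        by (simp add: divide_right_mono)
      also have "\<dots> = 1 / (real N)\<^sup>2"
        using assms by (simp add: n_def power2_eq_square)
      finally have kn: "0 \<le> 1 / (real N)\<^sup>2 - (k / n - d i)\<^sup>2"
        by simp
      \<comment> \<open>The parallelogram identity for \<open>x - k / n\<close> and
        \<open>k / n - d i\<close>: the second square on the right is centred at the reflection of
        \<open>d i\<close> in \<open>k / n\<close>.\<close>
      have eq: "smult 2 ((s (k / n))\<^sup>2 * bern n k) + smult (2 / (real N)\<^sup>2) (bern n k)
        = (s (d i))\<^sup>2 * bern n k + (s (2 * (k / n) - d i))\<^sup>2 * bern n k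
          + smult (2 * (1 / (real N)\<^sup>2 - (k / n - d i)\<^sup>2)) (bern n k)"
        by (rule poly_ext) (simp add: s_def power2_eq_square algebra_simps)
      have "pos_poly ((s (2 * (k / n) - d i))\<^sup>2 * bern n k)"
        "pos_poly (smult (2 * (1 / (real N)\<^sup>2 - (k / n - d i)\<^sup>2)) (bern n k))"
        using kn by (intro pos_poly_square pos_poly_smult pos_poly_bern_mult; simp)+
      then show ?thesis
        using arg_cong [OF eq, of "\<lambda>p. rip (peval p D z) z"]
        unfolding pos_poly_def
        by (simp add: peval_add [OF lin] peval_smult [OF lin] rip_linear)
    qed
    have "(\<Sum>i\<le>N. (norm (D (peval (\<phi> i) D z) - d i *\<^sub>R peval (\<phi> i) D z))\<^sup>2)
        = (\<Sum>i\<le>N. rip (peval ((s (d i))\<^sup>2 * (\<phi> i)\<^sup>2) D z) z)"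
    proof (rule sum.cong)
      fix i
      have "D (peval (\<phi> i) D z) - d i *\<^sub>R peval (\<phi> i) D z = peval (s (d i) * \<phi> i) D z"
        unfolding s_def peval_mult [OF lin] peval_linear_factor [OF lin] by simp
      then show "(norm (D (peval (\<phi> i) D z) - d i *\<^sub>R peval (\<phi> i) D z))\<^sup>2 = rip (peval ((s (d i))\<^sup>2 * (\<phi> i)\<^sup>2) D z) z"
        by (simp add: norm_peval_sq power_mult_distrib)
    qed simp
    also have "\<dots> \<le> (\<Sum>i\<le>N. rip (peval ((s (d i))\<^sup>2 * \<phi> i) D z) z)"
      by (intro sum_mono sq_le) simp
    also have "\<dots> = (\<Sum>i\<le>N. \<Sum>k\<in>G i. rip (peval ((s (d i))\<^sup>2 * bern n k) D z) z)"
      by (simp add: \<phi>_def sum_distrib_left peval_sum [OF lin] rip_sum_left)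
    also have "\<dots> \<le> (\<Sum>i\<le>N. \<Sum>k\<in>G i. rip (peval (smult 2 ((s (k / n))\<^sup>2 * bern n k) + smult (2 / (real N)\<^sup>2) (bern n k)) D z) z)"
      using split by (intro sum_mono) (simp add: peval_add [OF lin] peval_smult [OF lin] rip_linear)
    also have "\<dots> = rip (peval (\<Sum>i\<le>N. \<Sum>k\<in>G i. smult 2 ((s (k / n))\<^sup>2 * bern n k) + smult (2 / (real N)\<^sup>2) (bern n k)) D z) z"
      by (simp add: peval_sum [OF lin] rip_sum_left)
    \<comment> \<open>Over all blocks together the two terms add up to the variance and to the
      partition of unity.\<close>
    also have "(\<Sum>i\<le>N. \<Sum>k\<in>G i. smult 2 ((s (k / n))\<^sup>2 * bern n k) + smult (2 / (real N)\<^sup>2) (bern n k))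
        = smult 2 (smult (1 / real n) ([:0, 1:] * [:1, -1:])) + smult (2 / (real N)\<^sup>2) 1"
      unfolding regroup sum.distrib smult_sum_right [symmetric] sum_bern s_def sum_bern_second_moment [OF n0] ..
    also have "rip (peval \<dots> D z) z = 2 / n * (rip (D z) z - (norm (D z))\<^sup>2) + 2 / (real N)\<^sup>2 * (norm z)\<^sup>2"
    proof -
      interpret bounded_linear D by (rule lin)
      show ?thesis
        unfolding peval_add [OF lin] peval_smult [OF lin] peval_mult [OF lin] peval_linear_factor [OF lin] peval_1 [OF lin]
        by (simp add: rip_linear diff rsymD [OF sym] rip_self)
    qed
    also have "\<dots> \<le> 2 / n * (norm z)\<^sup>2 + 2 / (real N)\<^sup>2 * (norm z)\<^sup>2"
    proof -
      have "rip (D z) z - (norm (D z))\<^sup>2 \<le> (norm z)\<^sup>2"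
        using le1 [of z] zero_le_power2 [of "norm (D z)"] by linarith
      then show ?thesis
        by (intro add_right_mono mult_left_mono) simp_all
    qed
    also have "\<dots> = 4 / (real N)\<^sup>2 * (norm z)\<^sup>2"
      by (simp add: n_def)
    finally show "(\<Sum>i\<le>N. (norm (D (peval (\<phi> i) D z) - (real i / real N) *\<^sub>R peval (\<phi> i) D z))\<^sup>2)
       \<le> 4 / (real N)\<^sup>2 * (norm z)\<^sup>2"
      by (simp add: d_def)
  qed
qed

end

text \<open>
  \<open>D\<close> acts on each piece of the decomposition approximately as a scalar, hence so does \<open>Q\<close>;
  the number of pieces enters only through Cauchy--Schwarz.
\<close>

lemma commute_of_approximate_eigenvectors_unit:
  assumes lin: "bounded_linear D" and sym: "rsym D"
    and ge0: "\<And>x. 0 \<le> rip (D x) x" and le1: "\<And>x. rip (D x) x \<le> (norm x)\<^sup>2"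
    and Q: "bounded_linear Q"
    and eig: "\<And>z d. 0 \<le> d \<Longrightarrow> d \<le> 1 \<Longrightarrow> \<exists>s. \<bar>s\<bar> \<le> c \<and> norm (Q z - s *\<^sub>R z) \<le> C * norm (D z - d *\<^sub>R z)"
  shows "Q (D z) = D (Q z)"
proof -
  interpret D: bounded_linear D by (rule lin)
  interpret Q: bounded_linear Q by (rule Q)
  obtain KD where KD: "0 < KD" "norm (D x) \<le> norm x * KD" for x
    using D.pos_bounded by blast
  obtain KQ where KQ: "0 < KQ" "norm (Q x) \<le> norm x * KQ" for x
    using Q.pos_bounded by blast
  define C' where "C' = KQ + \<bar>c\<bar> + (KD + 1) * \<bar>C\<bar>"
  have single: "norm (Q (D z) - D (Q z)) \<le> C' * norm (D z - d *\<^sub>R z)" if d: "0 \<le> d" "d \<le> 1" for z d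
  proof -
    obtain s where s: "\<bar>s\<bar> \<le> c" "norm (Q z - s *\<^sub>R z) \<le> C * norm (D z - d *\<^sub>R z)"
      using eig [OF d] by blast
    define u v where "u = D z - d *\<^sub>R z" and "v = Q z - s *\<^sub>R z"
    \<comment> \<open>The commutator does not change when scalars are subtracted from
      \<open>Q\<close> and \<open>D\<close>, so it is controlled by the two errors \<open>u\<close>
      and \<open>v\<close>.\<close>
    have "Q (D z) - D (Q z) = (Q u - s *\<^sub>R u) - (D v - d *\<^sub>R v)"
      by (simp add: u_def v_def D.diff D.scaleR Q.diff Q.scaleR algebra_simps)
    also have "norm \<dots> \<le> norm (Q u) + norm (s *\<^sub>R u) + (norm (D v) + norm (d *\<^sub>R v))"
      by (intro order_trans [OF norm_triangle_ineq4] add_mono order_refl)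
    also have "\<dots> \<le> KQ * norm u + \<bar>c\<bar> * norm u + (KD * norm v + 1 * norm v)"
      using KD(2) [of v] KQ(2) [of u] s(1) d
      by (intro add_mono) (auto simp: mult.commute intro: mult_right_mono mult_left_le_one_le)
    also have "\<dots> = (KQ + \<bar>c\<bar>) * norm u + (KD + 1) * norm v"
      by (simp add: algebra_simps)
    also have "\<dots> \<le> (KQ + \<bar>c\<bar>) * norm u + (KD + 1) * (\<bar>C\<bar> * norm u)"
    proof -
      have "norm v \<le> \<bar>C\<bar> * norm u"
        using s(2) mult_right_mono [OF abs_ge_self [of C] norm_ge_zero [of u]]
        unfolding u_def v_def by (rule order_trans)
      then show ?thesis
        using KD(1) by (intro add_left_mono mult_left_mono) auto
    qed
    finally show ?thesis
      by (simp add: C'_def u_def algebra_simps)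
  qed
  have C'0: "0 \<le> C'"
    using KD(1) KQ(1) by (simp add: C'_def)
  define e where "e = norm (Q (D z) - D (Q z))"
  \<comment> \<open>Cauchy--Schwarz over the \<open>N + 1 <= 2 N\<close> pieces costs a factor
    \<open>2 N\<close>, against a total squared error of order \<open>1 / N^2\<close>.\<close>
  have bound: "e\<^sup>2 \<le> 8 * C'\<^sup>2 * (norm z)\<^sup>2 * inverse (real N)" if N: "N > 0" for N
  proof -
    obtain \<phi> :: "nat \<Rightarrow> real poly" where \<phi>: "\<forall>z. (\<Sum>i\<le>N. peval (\<phi> i) D z) = z
      \<and> (\<Sum>i\<le>N. (norm (peval (\<phi> i) D z))\<^sup>2) \<le> (norm z)\<^sup>2
      \<and> (\<Sum>i\<le>N. (norm (D (peval (\<phi> i) D z) - (real i / real N) *\<^sub>R peval (\<phi> i) D z))\<^sup>2)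
         \<le> 4 / (real N)\<^sup>2 * (norm z)\<^sup>2"
      using approximate_spectral_decomposition [OF lin sym ge0 le1 N] by blast
    define w where "w i = peval (\<phi> i) D z" for i
    have "Q (D z) - D (Q z) = (\<Sum>i\<le>N. Q (D (w i)) - D (Q (w i)))"
      using \<phi> [rule_format, of z] by (simp add: w_def sum_subtractf flip: D.sum Q.sum)
    then have "e\<^sup>2 \<le> real (card {..N}) * (\<Sum>i\<le>N. (norm (Q (D (w i)) - D (Q (w i))))\<^sup>2)"
      using norm_sum_sq_le [of "\<lambda>i. Q (D (w i)) - D (Q (w i))" "{..N}"] by (simp add: e_def)
    also have "\<dots> \<le> real (card {..N}) * (\<Sum>i\<le>N. (C' * norm (D (w i) - (real i / real N) *\<^sub>R w i))\<^sup>2)"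
      using N by (intro mult_left_mono sum_mono power_mono single) (auto simp: divide_le_eq_1)
    also have "\<dots> = real (N + 1) * (C'\<^sup>2 * (\<Sum>i\<le>N. (norm (D (w i) - (real i / real N) *\<^sub>R w i))\<^sup>2))"
      by (simp add: power_mult_distrib sum_distrib_left)
    also have "\<dots> \<le> real (2 * N) * (C'\<^sup>2 * (4 / (real N)\<^sup>2 * (norm z)\<^sup>2))"
      using \<phi> [rule_format, of z] that unfolding w_def
      by (intro mult_mono mult_left_mono) (auto intro!: mult_nonneg_nonneg sum_nonneg)
    also have "\<dots> = 8 * C'\<^sup>2 * (norm z)\<^sup>2 * inverse (real N)"
      using that by (simp add: field_simps power2_eq_square)
    finally show ?thesis .
  qed
  have "(\<lambda>N. 8 * C'\<^sup>2 * (norm z)\<^sup>2 * inverse (real N)) \<longlonglongrightarrow> 8 * C'\<^sup>2 * (norm z)\<^sup>2 * 0"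
    by (intro tendsto_intros lim_inverse_n)
  then have "e\<^sup>2 \<le> 8 * C'\<^sup>2 * (norm z)\<^sup>2 * 0"
    by (rule tendsto_lowerbound) (use bound in \<open>auto intro: eventually_mono [OF eventually_gt_at_top [of 0]]\<close>)
  then show ?thesis
    by (simp add: e_def)
qed

text \<open>An approximate kernel vector of \<open>T\<close> is cut into spectral pieces of
  \<open>D\<close>. Since \<open>T\<close> commutes with the cutting, its squared errors on the
  pieces add up to at most the squared error on the whole vector. Averaging finds a piece good for
  both operators, and compactness of the unit interval makes \<open>d\<close> independent of the
  tolerance.\<close>

lemma joint_approximate_eigenvalue_unit:
  assumes lin: "bounded_linear D" and sym: "rsym D"
    and ge0: "\<And>x. 0 \<le> rip (D x) x" and le1: "\<And>x. rip (D x) x \<le> (norm x)\<^sup>2"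
    and T: "bounded_linear T" and comm: "\<And>z. T (D z) = D (T z)"
    and approx: "\<And>e. e > 0 \<Longrightarrow> \<exists>u. u \<noteq> 0 \<and> norm (T u) \<le> e * norm u"
  obtains d where "0 \<le> d" "d \<le> 1"
    "\<And>e. e > 0 \<Longrightarrow> \<exists>u. u \<noteq> 0 \<and> norm (T u) \<le> e * norm u \<and> norm (D u - d *\<^sub>R u) \<le> e * norm u"
proof -
  have step: "\<exists>d u. 0 \<le> d \<and> d \<le> 1 \<and> u \<noteq> 0
      \<and> (norm (D u - d *\<^sub>R u))\<^sup>2 + (norm (T u))\<^sup>2 \<le> 10 * inverse (real N) * (norm u)\<^sup>2" if N: "N > 0" for N
  proof -
    obtain \<phi> :: "nat \<Rightarrow> real poly" where \<phi>: "\<forall>z. (\<Sum>i\<le>N. peval (\<phi> i) D z) = z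
      \<and> (\<Sum>i\<le>N. (norm (peval (\<phi> i) D z))\<^sup>2) \<le> (norm z)\<^sup>2
      \<and> (\<Sum>i\<le>N. (norm (D (peval (\<phi> i) D z) - (real i / real N) *\<^sub>R peval (\<phi> i) D z))\<^sup>2)
         \<le> 4 / (real N)\<^sup>2 * (norm z)\<^sup>2"
      using approximate_spectral_decomposition [OF lin sym ge0 le1 N] by blast
    obtain u where u: "u \<noteq> 0" "norm (T u) \<le> 1 / real N * norm u"
      using approx [of "1 / real N"] N by auto
    define w where "w i = peval (\<phi> i) D u" for i
    define E where "E i = (norm (D (w i) - (real i / real N) *\<^sub>R w i))\<^sup>2 + (norm (T (w i)))\<^sup>2" for i
    have Tw: "T (w i) = peval (\<phi> i) D (T u)" for i
      unfolding w_def by (rule peval_commute [OF lin T comm])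
    have "(\<Sum>i\<le>N. E i) \<le> 4 / (real N)\<^sup>2 * (norm u)\<^sup>2 + (norm (T u))\<^sup>2"
      unfolding E_def Tw sum.distrib using \<phi> [rule_format, of u] \<phi> [rule_format, of "T u"]
      by (intro add_mono) (simp_all add: w_def)
    also have "\<dots> \<le> 4 / (real N)\<^sup>2 * (norm u)\<^sup>2 + (1 / real N * norm u)\<^sup>2"
      using u(2) by (intro add_left_mono power_mono) auto
    also have "\<dots> = 5 / (real N)\<^sup>2 * (norm u)\<^sup>2"
      by (simp add: power_divide field_simps)
    also have "\<dots> \<le> 5 / (real N)\<^sup>2 * (real (2 * N) * (\<Sum>i\<le>N. (norm (w i))\<^sup>2))"
    proof (rule mult_left_mono)
      have "(norm u)\<^sup>2 \<le> real (card {..N}) * (\<Sum>i\<le>N. (norm (w i))\<^sup>2)"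
        using norm_sum_sq_le [of w "{..N}"] \<phi> [rule_format, of u] by (simp add: w_def)
      also have "\<dots> \<le> real (2 * N) * (\<Sum>i\<le>N. (norm (w i))\<^sup>2)"
        using N by (intro mult_right_mono sum_nonneg) auto
      finally show "(norm u)\<^sup>2 \<le> real (2 * N) * (\<Sum>i\<le>N. (norm (w i))\<^sup>2)" .
    qed simp
    also have "\<dots> = (\<Sum>i\<le>N. 10 * inverse (real N) * (norm (w i))\<^sup>2)"
      using that by (simp add: field_simps power2_eq_square sum_distrib_left)
    finally have sum_le: "(\<Sum>i\<le>N. E i) \<le> (\<Sum>i\<le>N. 10 * inverse (real N) * (norm (w i))\<^sup>2)" .
    \<comment> \<open>If every nonzero piece failed, summing would contradict \<open>sum_le\<close>;
      some piece is nonzero because they add up to \<open>u\<close>.\<close>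
    have "\<exists>i\<le>N. w i \<noteq> 0 \<and> E i \<le> 10 * inverse (real N) * (norm (w i))\<^sup>2"
    proof (rule ccontr)
      assume neg: "\<not> ?thesis"
      have *: "10 * inverse (real N) * (norm (w i))\<^sup>2 < E i" if "i \<le> N" "w i \<noteq> 0" for i
        using neg that by force
      obtain i where i: "i \<le> N" "w i \<noteq> 0"
        using u(1) \<phi> [rule_format, of u] unfolding w_def [symmetric] by (metis atMost_iff sum.neutral)
      have "(\<Sum>i\<le>N. 10 * inverse (real N) * (norm (w i))\<^sup>2) < (\<Sum>i\<le>N. E i)"
      proof (rule sum_strict_mono_ex1)
        show "\<forall>i\<in>{..N}. 10 * inverse (real N) * (norm (w i))\<^sup>2 \<le> E i"
        proof
          fix i assume "i \<in> {..N}"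
          then show "10 * inverse (real N) * (norm (w i))\<^sup>2 \<le> E i"
            using * [of i] by (cases "w i = 0") (auto simp: E_def)
        qed
        show "\<exists>i\<in>{..N}. 10 * inverse (real N) * (norm (w i))\<^sup>2 < E i"
          using i * by auto
      qed simp
      with sum_le show False
        by simp
    qed
    then obtain i where "i \<le> N" "w i \<noteq> 0" "E i \<le> 10 * inverse (real N) * (norm (w i))\<^sup>2"
      by blast
    then show ?thesis
      using N unfolding E_def by (intro exI [of _ "real i / real N"] exI [of _ "w i"]) auto
  qed
  then obtain d u where du: "\<And>N. N > 0 \<Longrightarrow> 0 \<le> d N \<and> d N \<le> 1 \<and> u N \<noteq> 0
      \<and> (norm (D (u N) - d N *\<^sub>R u N))\<^sup>2 + (norm (T (u N)))\<^sup>2 \<le> 10 * inverse (real N) * (norm (u N))\<^sup>2"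
    by metis
  \<comment> \<open>Below, \<open>d\<close> is shifted by \<open>Suc\<close> because
    \<open>du\<close> says nothing about index \<open>0\<close>.\<close>
  have "seq_compact {0..1::real}"
    using compact_Icc compact_imp_seq_compact by blast
  moreover have "\<forall>n. d (Suc n) \<in> {0..1}"
    using du by simp
  ultimately obtain d0 r where d0: "d0 \<in> {0..1}" "strict_mono r" "((\<lambda>n. d (Suc n)) \<circ> r) \<longlonglongrightarrow> d0"
    unfolding seq_compact_def by metis
  have final: "\<exists>u. u \<noteq> 0 \<and> norm (T u) \<le> e * norm u \<and> norm (D u - d0 *\<^sub>R u) \<le> e * norm u" if "e > 0" for e
  proof -
    have "(\<lambda>n. 10 * inverse (real (Suc n))) \<longlonglongrightarrow> 10 * 0"
      by (intro tendsto_intros LIMSEQ_inverse_real_of_nat)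
    then have "(\<lambda>n. 10 * inverse (real (Suc (r n)))) \<longlonglongrightarrow> 10 * 0"
      using LIMSEQ_subseq_LIMSEQ [OF _ d0(2)] by (force simp: o_def)
    then have "eventually (\<lambda>n. 10 * inverse (real (Suc (r n))) < (e / 2)\<^sup>2) sequentially"
      by (rule order_tendstoD(2)) (use that in auto)
    moreover have "eventually (\<lambda>n. dist (d (Suc (r n))) d0 < e / 2) sequentially"
      using tendstoD [OF d0(3), of "e / 2"] that by (simp add: o_def)
    ultimately obtain n where n: "10 * inverse (real (Suc (r n))) < (e / 2)\<^sup>2" "dist (d (Suc (r n))) d0 < e / 2"
      using eventually_happens' [OF _ eventually_conj] sequentially_bot by blast
    define N v where "N = Suc (r n)" and "v = u N"
    have v: "v \<noteq> 0" "(norm (D v - d N *\<^sub>R v))\<^sup>2 + (norm (T v))\<^sup>2 \<le> 10 * inverse (real N) * (norm v)\<^sup>2"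
      using du [of N] by (auto simp: N_def v_def)
    have "10 * inverse (real N) * (norm v)\<^sup>2 \<le> (e / 2 * norm v)\<^sup>2"
      unfolding power_mult_distrib using n(1) by (intro mult_right_mono) (auto simp: N_def)
    with v(2) have "(norm (D v - d N *\<^sub>R v))\<^sup>2 \<le> (e / 2 * norm v)\<^sup>2" "(norm (T v))\<^sup>2 \<le> (e / 2 * norm v)\<^sup>2"
      using zero_le_power2 [of "norm (T v)"] zero_le_power2 [of "norm (D v - d N *\<^sub>R v)"] by linarith+
    then have 1: "norm (D v - d N *\<^sub>R v) \<le> e / 2 * norm v" "norm (T v) \<le> e / 2 * norm v"
      using that by (auto intro!: power2_le_imp_le)
    have "norm (D v - d0 *\<^sub>R v) \<le> norm (D v - d N *\<^sub>R v) + norm ((d N - d0) *\<^sub>R v)"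
      using norm_triangle_ineq [of "D v - d N *\<^sub>R v" "(d N - d0) *\<^sub>R v"] by (simp add: algebra_simps)
    also have "\<dots> \<le> e / 2 * norm v + e / 2 * norm v"
      using 1(1) n(2) unfolding norm_scaleR by (intro add_mono mult_right_mono) (auto simp: N_def dist_real_def)
    finally have "norm (D v - d0 *\<^sub>R v) \<le> e * norm v"
      by simp
    moreover have "norm (T v) \<le> e * norm v"
      using 1(2) that by (smt (verit) mult_right_mono norm_ge_zero field_sum_of_halves)
    ultimately show ?thesis
      using v(1) by blast
  qed
  show thesis
    by (rule that [OF _ _ final]) (use d0(1) in auto)
qed

section \<open>Extension to positive operators of any norm by rescaling\<close>

lemma rip_bounded:
  assumes "bounded_linear D"
  obtains M where "M > 0" "\<And>x. rip (D x) x \<le> M * (norm x)\<^sup>2"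
proof -
  obtain K where K: "0 < K" "norm (D x) \<le> norm x * K" for x
    using bounded_linear.pos_bounded [OF assms] by blast
  have "rip (D x) x \<le> K * (norm x)\<^sup>2" for x
  proof -
    have "rip (D x) x \<le> norm (D x) * norm x"
      by (rule rip_le_norms)
    also have "\<dots> \<le> (norm x * K) * norm x"
      by (intro mult_right_mono K) simp
    finally show ?thesis
      by (simp add: power2_eq_square mult_ac)
  qed
  with K(1) show thesis
    by (rule that)
qed

text \<open>Division by a form bound \<open>M\<close> reduces to the normalised case. The hypothesis
  \<open>eig\<close> ranges over every \<open>M\<close> because this bound is chosen only inside the
  proof; \<open>c\<close> and \<open>C\<close> may depend on it.\<close>

lemma commute_of_approximate_eigenvectors:
  assumes lin: "bounded_linear D" and sym: "rsym D"
    and ge0: "\<And>x. 0 \<le> rip (D x) x"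
    and Q: "bounded_linear Q"
    and eig: "\<And>M. \<exists>c C. \<forall>z d. 0 \<le> d \<longrightarrow> d \<le> M \<longrightarrow>
      (\<exists>s. \<bar>s\<bar> \<le> c \<and> norm (Q z - s *\<^sub>R z) \<le> C * norm (D z - d *\<^sub>R z))"
  shows "Q (D z) = D (Q z)"
proof -
  interpret Q: bounded_linear Q by (rule Q)
  obtain M where M: "M > 0" "\<And>x. rip (D x) x \<le> M * (norm x)\<^sup>2"
    using rip_bounded [OF lin] by blast
  obtain c C where cC: "\<And>z d. 0 \<le> d \<Longrightarrow> d \<le> M \<Longrightarrow>
      \<exists>s. \<bar>s\<bar> \<le> c \<and> norm (Q z - s *\<^sub>R z) \<le> C * norm (D z - d *\<^sub>R z)"
    using eig [of M] by blast
  define D' where "D' x = (1 / M) *\<^sub>R D x" for x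
  have "Q (D' z) = D' (Q z)"
  proof (rule commute_of_approximate_eigenvectors_unit [where D = D' and Q = Q and c = c and C = "C * M"])
    show "bounded_linear D'"
      unfolding D'_def by (intro bounded_linear_intros lin)
    show "rsym D'"
      by (simp add: rsym_def D'_def rip_linear rsymD [OF sym])
    show "0 \<le> rip (D' x) x" "rip (D' x) x \<le> (norm x)\<^sup>2" for x
      using M ge0 by (simp_all add: D'_def rip_linear field_simps)
    fix z and d :: real
    assume d: "0 \<le> d" "d \<le> 1"
    have "D' z - d *\<^sub>R z = (1 / M) *\<^sub>R (D z - (M * d) *\<^sub>R z)"
      using M(1) by (simp add: D'_def algebra_simps)
    then show "\<exists>s. \<bar>s\<bar> \<le> c \<and> norm (Q z - s *\<^sub>R z) \<le> C * M * norm (D' z - d *\<^sub>R z)"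
      using cC [of "M * d" z] d M(1) by (simp add: mult_left_le)
  qed (rule Q)
  then show ?thesis
    using M(1) by (simp add: D'_def Q.scaleR)
qed

lemma joint_approximate_eigenvalue:
  assumes lin: "bounded_linear D" and sym: "rsym D"
    and ge0: "\<And>x. 0 \<le> rip (D x) x"
    and T: "bounded_linear T" and comm: "\<And>z. T (D z) = D (T z)"
    and approx: "\<And>e. e > 0 \<Longrightarrow> \<exists>u. u \<noteq> 0 \<and> norm (T u) \<le> e * norm u"
  obtains d where
    "\<And>e. e > 0 \<Longrightarrow> \<exists>u. u \<noteq> 0 \<and> norm (T u) \<le> e * norm u \<and> norm (D u - d *\<^sub>R u) \<le> e * norm u"
proof -
  interpret T: bounded_linear T by (rule T)
  obtain M where M: "M > 0" "\<And>x. rip (D x) x \<le> M * (norm x)\<^sup>2"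
    using rip_bounded [OF lin] by blast
  define D' where "D' x = (1 / M) *\<^sub>R D x" for x
  have "\<exists>d. \<forall>e>0. \<exists>u. u \<noteq> 0 \<and> norm (T u) \<le> e * norm u \<and> norm (D' u - d *\<^sub>R u) \<le> e * norm u"
  proof (rule joint_approximate_eigenvalue_unit [where D = D' and T = T])
    show "bounded_linear D'"
      unfolding D'_def by (intro bounded_linear_intros lin)
    show "rsym D'"
      by (simp add: rsym_def D'_def rip_linear rsymD [OF sym])
    show "0 \<le> rip (D' x) x" "rip (D' x) x \<le> (norm x)\<^sup>2" for x
      using M ge0 by (simp_all add: D'_def rip_linear field_simps)
    show "T (D' z) = D' (T z)" for z
      by (simp add: D'_def T.scaleR comm)
  qed (use T approx in blast)+
  then obtain d where d: "\<And>e. e > 0 \<Longrightarrow>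
      \<exists>u. u \<noteq> 0 \<and> norm (T u) \<le> e * norm u \<and> norm (D' u - d *\<^sub>R u) \<le> e * norm u"
    by blast
  show thesis
  proof (rule that [of "M * d"])
    fix e :: real
    assume e: "e > 0"
    \<comment> \<open>Scaling back multiplies the error of \<open>D'\<close> by \<open>M\<close> but
      leaves that of \<open>T\<close> unchanged, so the tolerance has to serve both.\<close>
    then have "min e (e / M) > 0"
      using M(1) by simp
    then obtain u where u: "u \<noteq> 0" "norm (T u) \<le> min e (e / M) * norm u"
        "norm (D' u - d *\<^sub>R u) \<le> min e (e / M) * norm u"
      using d by blast
    have "norm (T u) \<le> e * norm u"
      using u(2) by (rule order_trans) (simp add: mult_right_mono)
    moreover have "D u - (M * d) *\<^sub>R u = M *\<^sub>R (D' u - d *\<^sub>R u)"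
      using M(1) by (simp add: D'_def algebra_simps)
    then have "norm (D u - (M * d) *\<^sub>R u) = M * norm (D' u - d *\<^sub>R u)"
      using M(1) by simp
    then have "norm (D u - (M * d) *\<^sub>R u) \<le> M * (e / M * norm u)"
      using u(3) M(1) by (metis (no_types, lifting) less_imp_le min.cobounded2 mult_left_mono
          mult_right_mono norm_ge_zero order_trans)
    ultimately show "\<exists>u. u \<noteq> 0 \<and> norm (T u) \<le> e * norm u \<and> norm (D u - (M * d) *\<^sub>R u) \<le> e * norm u"
      using u(1) M(1) by auto
  qed
qed

subsection \<open>Positive operators\<close>

lemma cinner_add_right: "cinner z (x + y) = cinner z x + cinner z y"
  by (metis cinner_add_left cinner_commute complex_cnj_add)

lemma cinner_scaleC_right: "cinner x (a *\<^sub>C y) = cnj a * cinner x y"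
  by (metis cinner_commute cinner_scaleC_left complex_cnj_mult)

lemma norm_scaleC: "norm (a *\<^sub>C x) = cmod a * norm x"
proof -
  have "cinner (a *\<^sub>C x) (a *\<^sub>C x) = (a * cnj a) * cinner x x"
    by (simp add: cinner_scaleC_left cinner_scaleC_right)
  then have "complex_of_real ((norm (a *\<^sub>C x))\<^sup>2) = complex_of_real ((cmod a * norm x)\<^sup>2)"
    by (simp only: cinner_self_norm complex_norm_square [symmetric] of_real_mult [symmetric] power_mult_distrib)
  then have "(norm (a *\<^sub>C x))\<^sup>2 = (cmod a * norm x)\<^sup>2"
    by (simp only: of_real_eq_iff)
  then show ?thesis
    by (simp add: power2_eq_iff_nonneg)
qed

lemma norm_cinner_le: "cmod (cinner x y) \<le> norm x * norm y"
proof (cases "cinner x y = 0")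
  case False
  \<comment> \<open>A unimodular scalar turning \<open>cinner x y\<close> into its modulus, which
    reduces the claim to the real inequality.\<close>
  define a where "a = cnj (cinner x y) / cmod (cinner x y)"
  have "cmod (cinner x y) = rip (a *\<^sub>C x) y"
    using False by (simp add: rip_def cinner_scaleC_left a_def complex_norm_square [symmetric] mult.commute
        power2_eq_square flip: of_real_mult)
  also have "\<dots> \<le> norm (a *\<^sub>C x) * norm y"
    by (rule rip_le_norms)
  also have "norm (a *\<^sub>C x) = norm x"
    using False by (simp add: norm_scaleC a_def norm_divide)
  finally show ?thesis .
qed simp

lemma bounded_clinearD:
  assumes "bounded_clinear A"
  shows "bounded_linear A" "A (c *\<^sub>C x) = c *\<^sub>C A x"
  using assms by (simp_all add: bounded_clinear_def)

text \<open>Polarisation: reality of the form at \<open>x + y\<close> settles the imaginary parts,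
  and at \<open>x + i y\<close> the real parts.\<close>

lemma positive_op_cinner_sym:
  assumes "positive_op A"
  shows "cinner (A x) y = cinner x (A y)"
proof -
  have A: "bounded_clinear A" and real: "Im (cinner (A x) x) = 0" for x
    using assms by (auto simp: positive_op_def complex_nonneg_Reals_iff)
  interpret bounded_linear A
    by (rule bounded_clinearD [OF A])
  have "Im (cinner (A x) y) = - Im (cinner (A y) x)"
    using real [of "x + y"] real [of x] real [of y] by (simp add: add cinner_add_left cinner_add_right)
  moreover have "Re (cinner (A x) y) = Re (cinner (A y) x)"
    using real [of "x + \<i> *\<^sub>C y"] real [of x] real [of y]
    by (simp add: add bounded_clinearD(2) [OF A] cinner_add_left cinner_add_right cinner_scaleC_left cinner_scaleC_right)
  ultimately have "cinner (A x) y = cnj (cinner (A y) x)"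
    by (simp add: complex_eq_iff)
  then show ?thesis
    by (simp flip: cinner_commute)
qed

lemma positive_opD:
  assumes "positive_op A"
  shows "bounded_clinear A" "rsym A" "0 \<le> rip (A x) x"
  using assms positive_op_cinner_sym [OF assms]
  by (auto simp: positive_op_def rsym_def rip_def complex_nonneg_Reals_iff)

text \<open>From \<open>0 <= A <= M\<close> follows \<open>A^2 <= M A\<close>, by testing positivity
  at \<open>x - A x / M\<close>. The lower bound then passes from \<open>A\<close> to its quadratic
  form, with \<open>m = 1 / (c^2 M)\<close>.\<close>

lemma positive_coercive:
  assumes lin: "bounded_linear A" and sym: "rsym A" and ge0: "\<And>x. 0 \<le> rip (A x) x"
    and below: "c > 0" "\<And>x. norm x \<le> c * norm (A x)"
  obtains m where "m > 0" "\<And>x. m * (norm x)\<^sup>2 \<le> rip (A x) x"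
proof -
  interpret bounded_linear A by (rule lin)
  obtain M where M: "M > 0" "\<And>x. rip (A x) x \<le> M * (norm x)\<^sup>2"
    using rip_bounded [OF lin] by blast
  have "1 / (c\<^sup>2 * M) * (norm x)\<^sup>2 \<le> rip (A x) x" for x
  proof -
    have "0 \<le> rip (A (x - (1 / M) *\<^sub>R A x)) (x - (1 / M) *\<^sub>R A x)"
      by (rule ge0)
    also have "\<dots> = rip (A x) x - 2 / M * (norm (A x))\<^sup>2 + 1 / M\<^sup>2 * rip (A (A x)) (A x)"
    proof -
      have "rip (A (x - t *\<^sub>R A x)) (x - t *\<^sub>R A x)
          = rip (A x) x - 2 * t * rip (A x) (A x) + t\<^sup>2 * rip (A (A x)) (A x)" for t
        by (simp add: diff scaleR rip_linear rsymD [OF sym, of "A x" x] power2_eq_square algebra_simps)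
      from this [of "1 / M"] show ?thesis
        by (simp add: rip_self power_divide)
    qed
    also have "\<dots> \<le> rip (A x) x - 2 / M * (norm (A x))\<^sup>2 + 1 / M\<^sup>2 * (M * (norm (A x))\<^sup>2)"
      using M by (intro add_left_mono mult_left_mono) auto
    also have "\<dots> = rip (A x) x - 1 / M * (norm (A x))\<^sup>2"
      using M(1) by (simp add: field_simps power2_eq_square)
    finally have "1 / M * (norm (A x))\<^sup>2 \<le> rip (A x) x"
      by simp
    moreover have "(norm x)\<^sup>2 \<le> (c * norm (A x))\<^sup>2"
      using below(2) by (intro power_mono) auto
    then have "1 / (c\<^sup>2 * M) * (norm x)\<^sup>2 \<le> 1 / (c\<^sup>2 * M) * (c\<^sup>2 * (norm (A x))\<^sup>2)"
      using M(1) below(1) by (intro mult_left_mono) (auto simp: power_mult_distrib)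
    then have "1 / (c\<^sup>2 * M) * (norm x)\<^sup>2 \<le> 1 / M * (norm (A x))\<^sup>2"
      using below(1) by simp
    ultimately show ?thesis
      by (rule order_trans [rotated])
  qed
  then show thesis
    using that [of "1 / (c\<^sup>2 * M)"] M(1) below(1) by simp
qed

subsection \<open>Joint approximate eigenvalues\<close>

definition joint_approximate :: "('a::complex_hilbert_space \<Rightarrow> 'a) \<Rightarrow> ('a \<Rightarrow> 'a) \<Rightarrow> real \<Rightarrow> real \<Rightarrow> bool" where
  "joint_approximate A B p q \<longleftrightarrow>
    (\<forall>e>0. \<exists>u. u \<noteq> 0 \<and> norm (A u - p *\<^sub>R u) \<le> e * norm u \<and> norm (B u - q *\<^sub>R u) \<le> e * norm u)"

definition approximate_eigenvalue :: "('a::complex_hilbert_space \<Rightarrow> 'a) \<Rightarrow> real \<Rightarrow> bool" where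
  "approximate_eigenvalue A p \<longleftrightarrow> (\<forall>e>0. \<exists>u. u \<noteq> 0 \<and> norm (A u - p *\<^sub>R u) \<le> e * norm u)"

lemma joint_approximate_commute: "joint_approximate A B p q \<longleftrightarrow> joint_approximate B A q p"
  by (simp add: joint_approximate_def conj_ac)

lemma joint_approximateD: "joint_approximate A B p q \<Longrightarrow> approximate_eigenvalue A p"
  unfolding joint_approximate_def approximate_eigenvalue_def by meson

lemma joint_approximate_extend:
  assumes A: "bounded_linear A" and B: "bounded_linear B" "rsym B" "\<And>x. 0 \<le> rip (B x) x"
    and comm: "\<And>z. A (B z) = B (A z)" and p: "approximate_eigenvalue A p"
  obtains q where "joint_approximate A B p q"
proof -
  interpret B: bounded_linear B by (rule B)
  note goal = that
  show thesis
  proof (rule joint_approximate_eigenvalue [OF B, where T = "\<lambda>u. A u - p *\<^sub>R u"])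
    show "bounded_linear (\<lambda>u. A u - p *\<^sub>R u)"
      by (intro bounded_linear_intros A)
    show "A (B z) - p *\<^sub>R B z = B (A z - p *\<^sub>R z)" for z
      by (simp add: B.diff B.scaleR comm)
    show "\<exists>u. u \<noteq> 0 \<and> norm (A u - p *\<^sub>R u) \<le> e * norm u" if "e > 0" for e
      using p that by (simp add: approximate_eigenvalue_def)
    show thesis if "\<And>e. e > 0 \<Longrightarrow> \<exists>u. u \<noteq> 0 \<and> norm (A u - p *\<^sub>R u) \<le> e * norm u
        \<and> norm (B u - q *\<^sub>R u) \<le> e * norm u" for q
      by (rule goal [of q]) (use that in \<open>simp add: joint_approximate_def\<close>)
  qed
qed

lemma approximate_eigenvalue_ge:
  assumes p: "approximate_eigenvalue A p" and m: "\<And>x. m * (norm x)\<^sup>2 \<le> rip (A x) x"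
  shows "m \<le> p"
proof (rule field_le_epsilon)
  fix e :: real
  assume "e > 0"
  then obtain u where u: "u \<noteq> 0" "norm (A u - p *\<^sub>R u) \<le> e * norm u"
    using p unfolding approximate_eigenvalue_def by blast
  have "m * (norm u)\<^sup>2 \<le> rip (A u) u"
    by (rule m)
  also have "\<dots> = p * (norm u)\<^sup>2 + rip (A u - p *\<^sub>R u) u"
    by (simp add: rip_linear rip_self)
  also have "\<dots> \<le> p * (norm u)\<^sup>2 + (e * norm u) * norm u"
    using u(2) by (intro add_left_mono order_trans [OF rip_le_norms] mult_right_mono) auto
  also have "\<dots> = (p + e) * (norm u)\<^sup>2"
    by (simp add: power2_eq_square algebra_simps)
  finally show "m \<le> p + e"
    using u(1) by simp
qed

lemma approximate_eigenvalue_le: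
  assumes p: "approximate_eigenvalue A p" and K: "\<And>x. norm (A x) \<le> K * norm x"
  shows "p \<le> K"
proof (rule field_le_epsilon)
  fix e :: real
  assume "e > 0"
  then obtain u where u: "u \<noteq> 0" "norm (A u - p *\<^sub>R u) \<le> e * norm u"
    using p unfolding approximate_eigenvalue_def by blast
  have "p * norm u \<le> norm (p *\<^sub>R u)"
    by (simp add: mult_right_mono)
  also have "\<dots> \<le> norm (A u) + norm (A u - p *\<^sub>R u)"
    using norm_triangle_ineq4 [of "A u" "A u - p *\<^sub>R u"] by simp
  also have "\<dots> \<le> (K + e) * norm u"
    using u(2) K [of u] by (simp add: algebra_simps)
  finally show "p \<le> K + e"
    using u(1) by simp
qed

text \<open>One of \<open>onorm R\<close> and its negative works. Otherwise
  \<open>R - \<rho>\<close> and \<open>R + \<rho>\<close> are both bounded below, hence so is their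
  product \<open>R^2 - \<rho>^2\<close>, and expanding its norm pushes the norm of \<open>R\<close>
  strictly below \<open>\<rho>\<close>.\<close>

lemma approximate_eigenvalue_exists:
  assumes lin: "bounded_linear R" and sym: "rsym R" and nz: "R x0 \<noteq> 0"
  obtains r where "r \<noteq> 0" "approximate_eigenvalue R r"
proof -
  interpret bounded_linear R by (rule lin)
  define \<rho> where "\<rho> = onorm R"
  have \<rho>: "\<rho> > 0"
    using nz onorm_pos_lt [OF lin] by (auto simp: \<rho>_def)
  have bd: "norm (R x) \<le> \<rho> * norm x" for x
    unfolding \<rho>_def by (rule onorm [OF lin])
  have "approximate_eigenvalue R \<rho> \<or> approximate_eigenvalue R (- \<rho>)"
  proof (rule ccontr)
    assume "\<not> ?thesis"
    then obtain a b where ab: "a > 0" "b > 0"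
      "\<And>u. u \<noteq> 0 \<Longrightarrow> a * norm u < norm (R u - \<rho> *\<^sub>R u)"
      "\<And>u. u \<noteq> 0 \<Longrightarrow> b * norm u < norm (R u - (- \<rho>) *\<^sub>R u)"
      unfolding approximate_eigenvalue_def by (auto simp: not_le)
    define c where "c = (a * b / \<rho>)\<^sup>2"
    have key: "(norm (R u))\<^sup>2 \<le> (\<rho>\<^sup>2 - c) * (norm u)\<^sup>2" for u
    proof -
      have a: "a * norm v \<le> norm (R v - \<rho> *\<^sub>R v)" and b: "b * norm v \<le> norm (R v + \<rho> *\<^sub>R v)" for v
        using ab(3,4) [of v] by (cases "v = 0"; simp add: zero)+
      define v where "v = R u + \<rho> *\<^sub>R u"
      have "a * (b * norm u) \<le> a * norm v"
        using b [of u] ab(1) unfolding v_def by (intro mult_left_mono) auto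
      also have "\<dots> \<le> norm (R v - \<rho> *\<^sub>R v)"
        by (rule a)
      also have "R v - \<rho> *\<^sub>R v = R (R u) - \<rho>\<^sup>2 *\<^sub>R u"
        by (simp add: v_def add scaleR power2_eq_square algebra_simps)
      finally have "(a * b * norm u)\<^sup>2 \<le> (norm (R (R u) - \<rho>\<^sup>2 *\<^sub>R u))\<^sup>2"
        using ab(1,2) by (intro power_mono) auto
      also have "\<dots> = (norm (R (R u)))\<^sup>2 - 2 * \<rho>\<^sup>2 * (norm (R u))\<^sup>2 + \<rho>\<^sup>2 * (\<rho>\<^sup>2 * (norm u)\<^sup>2)"
        unfolding norm_diff_scaleR_sq rsymD [OF sym, of "R u" u] rip_self by algebra
      also have "(norm (R (R u)))\<^sup>2 \<le> (\<rho> * norm (R u))\<^sup>2"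
        using bd by (intro power_mono) auto
      finally have "(a * b * norm u)\<^sup>2 \<le> \<rho>\<^sup>2 * (\<rho>\<^sup>2 * (norm u)\<^sup>2 - (norm (R u))\<^sup>2)"
        by (simp add: power_mult_distrib algebra_simps)
      then have "(a * b * norm u)\<^sup>2 / \<rho>\<^sup>2 \<le> \<rho>\<^sup>2 * (norm u)\<^sup>2 - (norm (R u))\<^sup>2"
        using \<rho> by (simp add: divide_le_eq mult.commute)
      then show ?thesis
        by (simp add: c_def power_mult_distrib power_divide algebra_simps)
    qed
    have c: "c > 0"
      using ab(1,2) \<rho> by (simp add: c_def)
    have "norm (R u) \<le> sqrt (\<rho>\<^sup>2 - c) * norm u" for u
    proof (cases "u = 0")
      case False
      have "0 \<le> (\<rho>\<^sup>2 - c) * (norm u)\<^sup>2"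
        by (rule order_trans [OF zero_le_power2 key])
      then have "0 \<le> \<rho>\<^sup>2 - c"
        using False by (simp add: zero_le_mult_iff)
      then have "(norm (R u))\<^sup>2 \<le> (sqrt (\<rho>\<^sup>2 - c) * norm u)\<^sup>2"
        using key [of u] by (simp add: power_mult_distrib)
      then show ?thesis
        using \<open>0 \<le> \<rho>\<^sup>2 - c\<close> by (auto intro!: power2_le_imp_le)
    qed (simp add: zero)
    moreover have nonneg: "0 \<le> \<rho>\<^sup>2 - c"
    proof -
      have "0 \<le> (\<rho>\<^sup>2 - c) * (norm x0)\<^sup>2"
        by (rule order_trans [OF zero_le_power2 key])
      moreover have "x0 \<noteq> 0"
        using nz zero by auto
      ultimately show ?thesis
        by (simp add: zero_le_mult_iff)
    qed
    ultimately have "\<rho> \<le> sqrt (\<rho>\<^sup>2 - c)"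
      unfolding \<rho>_def by (intro onorm_bound) auto
    then have "\<rho>\<^sup>2 \<le> \<rho>\<^sup>2 - c"
      using \<rho> nonneg power_mono [of \<rho> "sqrt (\<rho>\<^sup>2 - c)" 2] by simp
    with c show False
      by simp
  qed
  then show thesis
    using that [of \<rho>] that [of "- \<rho>"] \<rho> by auto
qed

text \<open>Along an orbit both \<open>x\<close> and \<open>1 / x\<close> turn out convex, and a bounded convex sequence cannot increase.\<close>

lemma bounded_convex_seq_nonincreasing:
  fixes x :: "nat \<Rightarrow> real"
  assumes conv: "\<And>n. 2 * x (Suc n) \<le> x n + x (Suc (Suc n))" and bound: "\<And>n. x n \<le> M"
  shows "x 1 \<le> x 0"
proof (rule ccontr)
  assume "\<not> x 1 \<le> x 0"
  define d where "d = x 1 - x 0"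
  have d: "d > 0"
    using \<open>\<not> x 1 \<le> x 0\<close> by (simp add: d_def)
  have diff: "d \<le> x (Suc n) - x n" for n
  proof (induction n)
    case (Suc n)
    then show ?case using conv [of n] by simp
  qed (simp add: d_def)
  have "x 0 + real n * d \<le> x n" for n
  proof (induction n)
    case (Suc n)
    then show ?case using diff [of n] by (simp add: algebra_simps)
  qed simp
  then have "real n * d \<le> M - x 0" for n
    using bound [of n] by (smt (verit))
  moreover obtain n where "M - x 0 < real n * d"
    using reals_Archimedean3 [OF d] by blast
  ultimately show False
    by (meson not_le)
qed

text \<open>For two consecutive pairs of the orbit, \<open>ineq\<close> is convexity of
  \<open>x\<close> at the middle index; with the pairs exchanged it is convexity of
  \<open>1 / x\<close>. Boundedness then gives \<open>x 1 <= x 0\<close> and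
  \<open>x 0 <= x 1\<close>.\<close>

lemma orbit_constant:
  fixes J :: "real \<Rightarrow> real \<Rightarrow> bool"
  assumes bounds: "0 < m" "\<And>p q. J p q \<Longrightarrow> m \<le> p \<and> p \<le> M"
    and ineq: "\<And>p q p' q'. J p q \<Longrightarrow> J p' q' \<Longrightarrow> 2 \<le> p / p' + q' / q"
    and extend: "\<And>p q. J p q \<Longrightarrow> \<exists>q'. J q q'"
    and start: "J p q"
  shows "p = q"
proof -
  \<comment> \<open>A choice of successors forced to send \<open>p\<close> to \<open>q\<close>, so
    that the orbit begins with the given pair.\<close>
  define g where "g a = (if a = p then q else SOME b. J a b)" for a
  have g: "J b (g b)" if "J a b" for a b
  proof (cases "b = p")
    case False
    then show ?thesis
      using someI_ex [OF extend [OF that]] by (simp add: g_def)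
  qed (use start in \<open>simp add: g_def\<close>)
  define x where "x n = (g ^^ n) p" for n
  have J: "J (x n) (x (Suc n))" for n
  proof (induction n)
    case 0
    show ?case using start by (simp add: x_def g_def)
  next
    case (Suc n)
    show ?case using g [OF Suc] by (simp add: x_def)
  qed
  have x: "m \<le> x n" "x n \<le> M" "0 < x n" for n
    using bounds(2) [OF J [of n]] bounds(1) by auto
  have "x 1 \<le> x 0"
  proof (rule bounded_convex_seq_nonincreasing [where M = M])
    show "2 * x (Suc n) \<le> x n + x (Suc (Suc n))" for n
      using ineq [OF J [of n] J [of "Suc n"]] x(3) [of "Suc n"] by (simp add: field_simps)
  qed (rule x)
  moreover have "1 / x 1 \<le> 1 / x 0"
  proof (rule bounded_convex_seq_nonincreasing [where M = "1 / m" and x = "\<lambda>n. 1 / x n"])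
    show "2 * (1 / x (Suc n)) \<le> 1 / x n + 1 / x (Suc (Suc n))" for n
    proof -
      have "1 / x (Suc n) * 2 \<le> 1 / x (Suc n) * (x (Suc n) / x n + x (Suc n) / x (Suc (Suc n)))"
        using ineq [OF J [of "Suc n"] J [of n]] x(3) [of "Suc n"] by (intro mult_left_mono) auto
      then show ?thesis
        using x(3) [of "Suc n"] by (simp add: distrib_left)
    qed
    show "1 / x n \<le> 1 / m" for n
      using x(1) bounds(1) by (simp add: frac_le)
  qed
  then have "x 0 \<le> x 1"
    using x(3) [of 0] x(3) [of 1] by (simp add: divide_le_eq le_divide_eq)
  ultimately have "x 0 = x 1"
    by simp
  then show ?thesis
    by (simp add: x_def g_def)
qed

subsection \<open>Consequences of the rank-one inequality\<close>

context
  fixes P Q P' Q' :: "'a::complex_hilbert_space \<Rightarrow> 'a" and m :: real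
  assumes P: "bounded_linear P" "rsym P" and Q: "bounded_linear Q" "rsym Q"
    and P': "bounded_linear P'" "\<And>x. P' (P x) = x"
    and Q': "bounded_linear Q'" "\<And>x. Q' (Q x) = x" "\<And>x. Q (Q' x) = x"
    and m: "m > 0" "\<And>x. m * (norm x)\<^sup>2 \<le> rip (P x) x" "\<And>x. m * (norm x)\<^sup>2 \<le> rip (Q x) x"
    and rank_one: "\<And>x y. 2 * norm x * norm y \<le> norm (P x) * norm (P' y) + norm (Q' x) * norm (Q y)"
begin

lemma P_Q_nonneg: "0 \<le> rip (P x) x" "0 \<le> rip (Q x) x"
  using m(2,3) [of x] m(1) by (meson less_imp_le mult_nonneg_nonneg order_trans zero_le_power2)+

text \<open>
  The test vectors \<open>x = Q z\<close>, \<open>y = P (Q z)\<close> are extremal when \<open>z\<close> is an eigenvector of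
  \<open>D = Q P Q\<close>, and then force \<open>Q z\<close> to be an eigenvector of \<open>P\<close>.
\<close>

lemma variance_le:
  assumes "z \<noteq> 0"
  defines "D \<equiv> \<lambda>z. Q (P (Q z))"
  obtains p where "m \<le> p" "norm (Q z) * norm (P (Q z) - p *\<^sub>R Q z) \<le> norm z * norm (D z - d *\<^sub>R z)"
proof -
  define e where "e = Q z"
  define \<alpha> where "\<alpha> = rip (P e) e"
  \<comment> \<open>The Rayleigh quotient of \<open>P\<close> at \<open>e\<close>, the scalar for
    which \<open>P e - p e\<close> is shortest.\<close>
  define p where "p = \<alpha> / (norm e)\<^sup>2"
  have e0: "e \<noteq> 0"
    using assms(1) Q'(2) [of z] linear_0 [OF bounded_linear.linear [OF Q'(1)]] by (auto simp: e_def)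
  have \<alpha>p: "\<alpha> = p * (norm e)\<^sup>2"
    using e0 by (simp add: p_def)
  have "m \<le> p"
    using m(2) [of e] e0 unfolding \<alpha>_def [symmetric] \<alpha>p by simp
  \<comment> \<open>The first summand in \<open>rank_one\<close> is
    \<open>norm (P e) * norm e\<close>, which cancels one of the two copies on the left.\<close>
  have "norm e * norm (P e) \<le> norm z * norm (D z)"
    using rank_one [of e "P e"] P'(2) Q'(2) by (simp add: e_def D_def mult.commute)
  then have "(norm e * norm (P e))\<^sup>2 \<le> (norm z * norm (D z))\<^sup>2"
    by (intro power_mono) auto
  moreover have "(norm e * norm (P e - p *\<^sub>R e))\<^sup>2 = (norm e * norm (P e))\<^sup>2 - \<alpha>\<^sup>2"
    unfolding power_mult_distrib norm_diff_scaleR_sq \<alpha>_def [symmetric] \<alpha>p by algebra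
  \<comment> \<open>Both expansions subtract the same \<open>\<alpha>^2\<close>, because
    \<open>rip (D z) z = rip (P e) e\<close>; the extra square accounts for \<open>d\<close> being
    arbitrary.\<close>
  moreover have "(norm z * norm (D z - d *\<^sub>R z))\<^sup>2
      = (norm z * norm (D z))\<^sup>2 - \<alpha>\<^sup>2 + (\<alpha> - d * (norm z)\<^sup>2)\<^sup>2"
  proof -
    have Dz: "rip (D z) z = \<alpha>"
      by (simp add: D_def \<alpha>_def e_def rsymD [OF Q(2), of "P (Q z)" z])
    show ?thesis
      unfolding power_mult_distrib norm_diff_scaleR_sq Dz by algebra
  qed
  ultimately have "(norm e * norm (P e - p *\<^sub>R e))\<^sup>2 \<le> (norm z * norm (D z - d *\<^sub>R z))\<^sup>2"
    using zero_le_power2 [of "\<alpha> - d * (norm z)\<^sup>2"] by linarith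
  then have "norm e * norm (P e - p *\<^sub>R e) \<le> norm z * norm (D z - d *\<^sub>R z)"
    by (rule power2_le_imp_le) simp
  with \<open>m \<le> p\<close> show thesis
    using that by (simp add: e_def)
qed

text \<open>Let \<open>D = Q P Q\<close>. If \<open>D z\<close> is close to \<open>d z\<close>, then
  \<open>variance_le\<close> makes \<open>P Q z\<close> close to \<open>p Q z\<close>. So
  \<open>D z\<close> is close to \<open>p Q^2 z\<close>, hence \<open>Q^2 z\<close> to
  \<open>(d / p) z\<close>, and positivity of \<open>Q\<close> permits taking the square root
  \<open>s = sqrt (d / p)\<close>.\<close>

lemma Q_approximate_scalar:
  "\<exists>c C. \<forall>z d. 0 \<le> d \<longrightarrow> d \<le> M \<longrightarrow>
     (\<exists>s. \<bar>s\<bar> \<le> c \<and> norm (Q z - s *\<^sub>R z) \<le> C * norm (Q (P (Q z)) - d *\<^sub>R z))"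
proof -
  interpret Q: bounded_linear Q by (rule Q)
  interpret P: bounded_linear P by (rule P)
  obtain KQ where KQ: "0 < KQ" "\<And>x. norm (Q x) \<le> norm x * KQ"
    using Q.pos_bounded by blast
  obtain KQi where KQi: "0 < KQi" "\<And>x. norm (Q' x) \<le> norm x * KQi"
    using bounded_linear.pos_bounded [OF Q'(1)] by blast
  define c where "c = sqrt (\<bar>M\<bar> / m)"
  define C where "C = (1 + KQ * KQi) / (m * m)"
  have "\<exists>s. \<bar>s\<bar> \<le> c \<and> norm (Q z - s *\<^sub>R z) \<le> C * norm (Q (P (Q z)) - d *\<^sub>R z)"
    if d: "0 \<le> d" "d \<le> M" for z d
  proof (cases "z = 0")
    case True
    then show ?thesis
      using m(1) by (intro exI [of _ 0]) (simp add: c_def Q.zero P.zero)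
  next
    case False
    define \<rho> where "\<rho> = norm (Q (P (Q z)) - d *\<^sub>R z)"
    obtain p where p: "m \<le> p" "norm (Q z) * norm (P (Q z) - p *\<^sub>R Q z) \<le> norm z * \<rho>"
      using variance_le [OF False, of d] unfolding \<rho>_def by blast
    have p0: "p > 0"
      using m(1) p(1) by simp
    have Qz: "norm (Q z) > 0"
      using False Q'(2) [of z] linear_0 [OF bounded_linear.linear [OF Q'(1)]] by auto
    have "norm (Q z) * norm (P (Q z) - p *\<^sub>R Q z) \<le> (norm (Q z) * KQi) * \<rho>"
      using p(2) KQi(2) [of "Q z"] unfolding Q'(2)
      by (rule order_trans [OF _ mult_right_mono]) (simp add: \<rho>_def)
    then have Pe: "norm (P (Q z) - p *\<^sub>R Q z) \<le> KQi * \<rho>"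
      using Qz by simp
    define s where "s = sqrt (d / p)"
    define v where "v = Q z - s *\<^sub>R z"
    have s: "0 \<le> s" "s\<^sup>2 = d / p"
      using d(1) p0 by (simp_all add: s_def)
    have "s \<le> c"
      unfolding s_def c_def using d p(1) m(1) by (intro real_sqrt_le_mono frac_le) auto
    \<comment> \<open>\<open>Q^2 - s^2\<close> factors as \<open>(Q + s) (Q - s)\<close>, and the
      first factor is bounded below by \<open>m\<close> since \<open>s >= 0\<close>.\<close>
    have "m * (norm v)\<^sup>2 \<le> rip (Q v) v"
      by (rule m)
    also have "\<dots> \<le> rip (Q v + s *\<^sub>R v) v"
      using s(1) by (simp add: rip_linear rip_self)
    also have "\<dots> \<le> norm (Q v + s *\<^sub>R v) * norm v"
      by (rule rip_le_norms)
    also have "Q v + s *\<^sub>R v = Q (Q z) - (d / p) *\<^sub>R z"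
      unfolding s(2) [symmetric] by (simp add: v_def Q.diff Q.scaleR power2_eq_square algebra_simps)
    finally have "m * norm v * norm v \<le> norm (Q (Q z) - (d / p) *\<^sub>R z) * norm v"
      by (simp add: power2_eq_square mult_ac)
    then have mv: "m * norm v \<le> norm (Q (Q z) - (d / p) *\<^sub>R z)"
      by (cases "v = 0") simp_all
    have "p *\<^sub>R (Q (Q z) - (d / p) *\<^sub>R z) = (Q (P (Q z)) - d *\<^sub>R z) - Q (P (Q z) - p *\<^sub>R Q z)"
      using p0 by (simp add: Q.diff Q.scaleR algebra_simps)
    then have "p * norm (Q (Q z) - (d / p) *\<^sub>R z) = norm ((Q (P (Q z)) - d *\<^sub>R z) - Q (P (Q z) - p *\<^sub>R Q z))"
      using p0 by (metis abs_of_pos norm_scaleR)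
    also have "\<dots> \<le> \<rho> + norm (P (Q z) - p *\<^sub>R Q z) * KQ"
      unfolding \<rho>_def by (intro order_trans [OF norm_triangle_ineq4] add_left_mono KQ)
    also have "\<dots> \<le> \<rho> + (KQi * \<rho>) * KQ"
      using Pe KQ(1) by (intro add_left_mono mult_right_mono) auto
    finally have "p * norm (Q (Q z) - (d / p) *\<^sub>R z) \<le> (1 + KQ * KQi) * \<rho>"
      by (simp add: algebra_simps)
    moreover have "m * (m * norm v) \<le> p * norm (Q (Q z) - (d / p) *\<^sub>R z)"
      using mv p(1) m(1) p0 by (intro mult_mono) auto
    ultimately have "m * m * norm v \<le> (1 + KQ * KQi) * \<rho>"
      by simp
    then have "norm v \<le> C * \<rho>"
      using m(1) by (simp add: C_def field_simps)
    with \<open>s \<le> c\<close> s(1) show ?thesis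
      unfolding v_def \<rho>_def by (intro exI [of _ s]) simp
  qed
  then show ?thesis
    by blast
qed

text \<open>Once \<open>Q\<close> commutes with \<open>Q P Q\<close>, cancelling \<open>Q\<close> on
  the left and inserting \<open>Q' z\<close> leaves the claim.\<close>

lemma P_Q_commute: "P (Q z) = Q (P z)"
proof -
  have *: "Q (Q (P (Q w))) = Q (P (Q (Q w)))" for w
  proof (rule commute_of_approximate_eigenvectors [where D = "\<lambda>z. Q (P (Q z))" and Q = Q])
    show "bounded_linear (\<lambda>z. Q (P (Q z)))"
      by (intro bounded_linear_compose [OF Q(1)] bounded_linear_compose [OF P(1)] Q(1))
    show "rsym (\<lambda>z. Q (P (Q z)))"
      by (simp add: rsym_def rsymD [OF Q(2)] rsymD [OF P(2)])
    show "0 \<le> rip (Q (P (Q x))) x" for x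
      using P_Q_nonneg(1) [of "Q x"] by (simp add: rsymD [OF Q(2), of "P (Q x)" x])
    show "bounded_linear Q"
      by (rule Q)
  qed (rule Q_approximate_scalar)
  have "Q (P (Q w)) = P (Q (Q w))" for w
    using arg_cong [OF * [of w], of Q'] by (simp add: Q'(2))
  from this [of "Q' z"] show ?thesis
    by (simp add: Q'(3))
qed

text \<open>Approximate joint eigenvectors for the two pairs go into \<open>rank_one\<close>:
  \<open>P\<close> and \<open>Q'\<close> act on the first as \<open>p\<close> and
  \<open>1 / q\<close>, \<open>P'\<close> and \<open>Q\<close> on the second as
  \<open>1 / p'\<close> and \<open>q'\<close>, up to errors that tend to zero.\<close>

lemma joint_approximate_ineq:
  assumes "joint_approximate P Q p q" "joint_approximate P Q p' q'"
  shows "2 \<le> p / p' + q' / q"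
proof -
  interpret P': bounded_linear P' by (rule P')
  interpret Q': bounded_linear Q' by (rule Q')
  have pos: "p > 0" "p' > 0" "q > 0" "q' > 0"
    using assms [THEN joint_approximateD, THEN approximate_eigenvalue_ge, OF m(2)] m(1)
      assms [unfolded joint_approximate_commute [of P], THEN joint_approximateD, THEN approximate_eigenvalue_ge, OF m(3)]
    by auto
  obtain K1 where K1: "0 < K1" "\<And>x. norm (P' x) \<le> norm x * K1"
    using P'.pos_bounded by blast
  obtain K2 where K2: "0 < K2" "\<And>x. norm (Q' x) \<le> norm x * K2"
    using Q'.pos_bounded by blast
  define F where "F e = (p + e) * ((1 + K1 * e) / p') + (1 + K2 * e) / q * (q' + e)" for e
  have approx: "norm (A u) \<le> (a + e) * norm u \<and> norm (Ai u) \<le> (1 + K * e) / a * norm u"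
    if A: "norm (A u - a *\<^sub>R u) \<le> e * norm u" and a: "a > 0" and Ai: "bounded_linear Ai" "Ai (A u) = u"
      and K: "0 < K" "\<And>x. norm (Ai x) \<le> norm x * K"
    for A Ai :: "'a \<Rightarrow> 'a" and a e K u
  proof
    interpret Ai: bounded_linear Ai by (rule Ai)
    show "norm (A u) \<le> (a + e) * norm u"
      using norm_triangle_ineq [of "A u - a *\<^sub>R u" "a *\<^sub>R u"] A a by (simp add: algebra_simps)
    have "a *\<^sub>R Ai u = u - Ai (A u - a *\<^sub>R u)"
      by (simp add: Ai.diff Ai.scaleR Ai(2))
    then have "a * norm (Ai u) = norm (u - Ai (A u - a *\<^sub>R u))"
      using a by (metis abs_of_pos norm_scaleR)
    also have "\<dots> \<le> norm u + norm (A u - a *\<^sub>R u) * K"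
      by (intro order_trans [OF norm_triangle_ineq4] add_left_mono K)
    also have "\<dots> \<le> norm u + (e * norm u) * K"
      using A K(1) by (intro add_left_mono mult_right_mono) auto
    finally show "norm (Ai u) \<le> (1 + K * e) / a * norm u"
      using a by (simp add: field_simps)
  qed
  have F: "2 \<le> F e" if e: "e > 0" for e
  proof -
    obtain u where u: "u \<noteq> 0" "norm (P u - p *\<^sub>R u) \<le> e * norm u" "norm (Q u - q *\<^sub>R u) \<le> e * norm u"
      using assms(1) e unfolding joint_approximate_def by meson
    obtain v where v: "v \<noteq> 0" "norm (P v - p' *\<^sub>R v) \<le> e * norm v" "norm (Q v - q' *\<^sub>R v) \<le> e * norm v"
      using assms(2) e unfolding joint_approximate_def by meson
    have "2 * norm u * norm v \<le> norm (P u) * norm (P' v) + norm (Q' u) * norm (Q v)"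
      by (rule rank_one)
    also have "\<dots> \<le> ((p + e) * norm u) * ((1 + K1 * e) / p' * norm v)
        + ((1 + K2 * e) / q * norm u) * ((q' + e) * norm v)"
      using approx [where A = P and Ai = P', OF u(2) pos(1) P' K1] approx [where A = P and Ai = P', OF v(2) pos(2) P' K1]
        approx [where A = Q and Ai = Q', OF u(3) pos(3) Q'(1,2) K2] approx [where A = Q and Ai = Q', OF v(3) pos(4) Q'(1,2) K2] pos e K1(1) K2(1)
      by (intro add_mono mult_mono) auto
    also have "\<dots> = F e * norm u * norm v"
      by (simp add: F_def algebra_simps)
    finally show ?thesis
      using u(1) v(1) by simp
  qed
  have "(F \<longlongrightarrow> F 0) (at_right 0)"
    unfolding F_def by (intro tendsto_intros) (use pos in auto)
  then have "2 \<le> F 0"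
    by (rule tendsto_lowerbound)
      (use F in \<open>auto simp: eventually_at_right_less intro: eventually_mono [OF eventually_at_right_less [of 0]]\<close>)
  then show ?thesis
    by (simp add: F_def)
qed

text \<open>If \<open>P\<close> and \<open>Q\<close> differ, \<open>P - Q\<close> has a nonzero
  approximate eigenvalue \<open>r\<close>. Joining it with \<open>P\<close> gives a joint pair
  \<open>(p, p - r)\<close> of \<open>P\<close> and \<open>Q\<close>, and the orbit argument forces
  \<open>r = 0\<close>.\<close>

lemma eq_of_spectra:
  assumes "(\<forall>p. approximate_eigenvalue Q p \<longrightarrow> approximate_eigenvalue P p)
    \<or> (\<forall>p. approximate_eigenvalue P p \<longrightarrow> approximate_eigenvalue Q p)"
  shows "P = Q"
proof (rule ccontr)
  assume "P \<noteq> Q"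
  then obtain x0 where x0: "P x0 - Q x0 \<noteq> 0"
    by (auto simp: fun_eq_iff)
  have R: "bounded_linear (\<lambda>x. P x - Q x)" "rsym (\<lambda>x. P x - Q x)"
    using P Q by (auto intro: bounded_linear_sub simp: rsym_def rip_linear rsymD)
  interpret P: bounded_linear P by (rule P)
  obtain r where r: "r \<noteq> 0" "approximate_eigenvalue (\<lambda>x. P x - Q x) r"
    using approximate_eigenvalue_exists [OF R x0] by blast
  have "P (P z) - Q (P z) = P (P z - Q z)" for z
    by (simp add: P.diff P_Q_commute)
  then obtain p where p: "joint_approximate (\<lambda>x. P x - Q x) P r p"
    using joint_approximate_extend [OF R(1) P P_Q_nonneg(1) _ r(2)] by blast
  have start: "joint_approximate P Q p (p - r)"
    unfolding joint_approximate_def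
  proof (intro allI impI)
    fix e :: real
    assume "e > 0"
    then have "e / 2 > 0"
      by simp
    then obtain u where u: "u \<noteq> 0" "norm (P u - Q u - r *\<^sub>R u) \<le> e / 2 * norm u" "norm (P u - p *\<^sub>R u) \<le> e / 2 * norm u"
      using p unfolding joint_approximate_def by meson
    have "Q u - (p - r) *\<^sub>R u = (P u - p *\<^sub>R u) - (P u - Q u - r *\<^sub>R u)"
      by (simp add: algebra_simps)
    then have "norm (Q u - (p - r) *\<^sub>R u) \<le> norm (P u - p *\<^sub>R u) + norm (P u - Q u - r *\<^sub>R u)"
      by (metis norm_triangle_ineq4)
    then have "norm (Q u - (p - r) *\<^sub>R u) \<le> e * norm u"
      using u(2,3) by simp
    moreover have "norm (P u - p *\<^sub>R u) \<le> e * norm u"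
      using u(3) norm_ge_zero [of "P u - p *\<^sub>R u"] by linarith
    ultimately show "\<exists>u. u \<noteq> 0 \<and> norm (P u - p *\<^sub>R u) \<le> e * norm u \<and> norm (Q u - (p - r) *\<^sub>R u) \<le> e * norm u"
      using u(1) by blast
  qed
  obtain KP where KP: "\<And>x. norm (P x) \<le> KP * norm x"
    using onorm [OF P(1)] by blast
  obtain KQ where KQ: "\<And>x. norm (Q x) \<le> KQ * norm x"
    using onorm [OF Q(1)] by blast
  have bounds: "m \<le> p" "p \<le> KP" "m \<le> q" "q \<le> KQ" if "joint_approximate P Q p q" for p q
  proof -
    have "approximate_eigenvalue P p" "approximate_eigenvalue Q q"
      using that joint_approximateD joint_approximate_commute by metis+
    then show "m \<le> p" "p \<le> KP" "m \<le> q" "q \<le> KQ"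
      using m(2,3) KP KQ by (auto intro: approximate_eigenvalue_ge approximate_eigenvalue_le)
  qed
  from assms have "p = p - r"
  proof
    assume sub: "\<forall>p. approximate_eigenvalue Q p \<longrightarrow> approximate_eigenvalue P p"
    show ?thesis
    proof (rule orbit_constant [where J = "joint_approximate P Q" and m = m and M = KP])
      fix p q
      assume "joint_approximate P Q p q"
      then have "approximate_eigenvalue P q"
        using sub joint_approximateD joint_approximate_commute by metis
      then show "\<exists>q'. joint_approximate P Q q q'"
        using joint_approximate_extend [OF P(1) Q P_Q_nonneg(2) P_Q_commute] by metis
    qed (use m(1) bounds joint_approximate_ineq start in auto)
  next
    assume sub: "\<forall>p. approximate_eigenvalue P p \<longrightarrow> approximate_eigenvalue Q p"
    \<comment> \<open>For this inclusion the orbit runs through reversed pairs;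
      \<open>joint_approximate_ineq\<close> with its two pairs exchanged is the inequality
      required.\<close>
    have "p - r = p"
    proof (rule orbit_constant [where J = "\<lambda>q p. joint_approximate P Q p q" and m = m and M = KQ])
      fix q p
      assume "joint_approximate P Q p q"
      then have "approximate_eigenvalue Q p"
        using sub joint_approximateD by metis
      then show "\<exists>p'. joint_approximate P Q p' p"
        using joint_approximate_extend [OF Q(1) P P_Q_nonneg(1) P_Q_commute [symmetric]] joint_approximate_commute by metis
    next
      fix q p q' p'
      assume "joint_approximate P Q p q" "joint_approximate P Q p' q'"
      then show "2 \<le> q / q' + p' / p"
        using joint_approximate_ineq [of p' q' p q] by simp
    qed (use m(1) bounds start in auto)
    then show ?thesis
      by simp
  qed
  with r(1) show False
    by simp
qed

end

subsection \<open>Spectrum of symmetric operators\<close>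

lemma scaleC_of_real: "complex_of_real r *\<^sub>C x = r *\<^sub>R x"
  by (simp add: scaleR_scaleC)

text \<open>\<open>1 - T^2 / M^2\<close> is a contraction when \<open>T\<close> is bounded below, so
  Banach's fixed point theorem solves \<open>T (T x) = y\<close>.\<close>

lemma rsym_bounded_below_surj:
  assumes lin: "bounded_linear T" and sym: "rsym T" and e: "e > 0" "\<And>x. e * norm x \<le> norm (T x)"
  shows "surj T"
proof -
  interpret bounded_linear T by (rule lin)
  obtain K where K: "0 < K" "\<And>x. norm (T x) \<le> norm x * K"
    using pos_bounded by blast
  \<comment> \<open>Adding \<open>e\<close> ensures \<open>e <= M\<close>, so that \<open>c\<close>
    is nonnegative.\<close>
  define M where "M = K + e"
  have M: "0 < M" "e \<le> M" "norm (T x) \<le> M * norm x" for x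
  proof -
    show "0 < M" "e \<le> M"
      using K(1) e(1) by (simp_all add: M_def)
    have "norm (T x) \<le> K * norm x"
      using K(2) [of x] by (simp add: mult.commute)
    also have "\<dots> \<le> M * norm x"
      using e(1) by (intro mult_right_mono) (simp_all add: M_def)
    finally show "norm (T x) \<le> M * norm x" .
  qed
  define c where "c = 1 - e\<^sup>2 / M\<^sup>2"
  have c: "0 \<le> c" "c < 1"
    using M(1,2) e(1) power_mono [of e M 2] by (simp_all add: c_def)
  have contr: "norm (x - (1 / M\<^sup>2) *\<^sub>R T (T x)) \<le> sqrt c * norm x" for x
  proof -
    have "(norm (x - (1 / M\<^sup>2) *\<^sub>R T (T x)))\<^sup>2
        = (norm x)\<^sup>2 - 2 / M\<^sup>2 * (norm (T x))\<^sup>2 + (1 / M\<^sup>2)\<^sup>2 * (norm (T (T x)))\<^sup>2"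
      unfolding norm_diff_scaleR_sq rsymD [OF sym, of x "T x", symmetric] rip_self by simp
    also have "\<dots> \<le> (norm x)\<^sup>2 - 2 / M\<^sup>2 * (norm (T x))\<^sup>2 + (1 / M\<^sup>2)\<^sup>2 * (M * norm (T x))\<^sup>2"
      using M by (intro add_left_mono mult_left_mono power_mono) auto
    also have "\<dots> = (norm x)\<^sup>2 - 1 / M\<^sup>2 * (norm (T x))\<^sup>2"
      using M(1) by (simp add: power_mult_distrib power2_eq_square)
    also have "\<dots> \<le> (norm x)\<^sup>2 - 1 / M\<^sup>2 * (e * norm x)\<^sup>2"
      using e by (intro diff_left_mono mult_left_mono power_mono) auto
    also have "\<dots> = (sqrt c * norm x)\<^sup>2"
      using c by (simp add: power_mult_distrib c_def algebra_simps)
    finally show ?thesis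
      using c by (auto intro: power2_le_imp_le)
  qed
  show ?thesis
    unfolding surj_def
  proof
    fix y
    define f where "f x = x - (1 / M\<^sup>2) *\<^sub>R (T (T x) - y)" for x
    have "\<exists>!x. f x = x"
    proof (rule banach_fix_type)
      show "0 \<le> sqrt c" "sqrt c < 1"
        using c by simp_all
      show "\<forall>x x'. dist (f x) (f x') \<le> sqrt c * dist x x'"
      proof (intro allI)
        fix x x'
        have "f x - f x' = (x - x') - (1 / M\<^sup>2) *\<^sub>R T (T (x - x'))"
          by (simp add: f_def diff algebra_simps)
        then show "dist (f x) (f x') \<le> sqrt c * dist x x'"
          using contr [of "x - x'"] by (simp add: dist_norm)
      qed
    qed
    then obtain x where "f x = x"
      by blast
    then have "y = T (T x)"
      using M(1) by (simp add: f_def)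
    then show "\<exists>x. y = T x"
      by blast
  qed
qed

lemma rsym_bounded_below_invertible:
  assumes T: "bounded_clinear T" "rsym T" and e: "e > 0" "\<And>x. e * norm x \<le> norm (T x)"
  shows "invertible_op T"
proof -
  interpret bounded_linear T by (rule bounded_clinearD [OF T(1)])
  have surj: "surj T"
    by (rule rsym_bounded_below_surj [OF bounded_clinearD(1) [OF T(1)] T(2) e])
  have inj: "inj T"
  proof (rule injI)
    fix x y
    assume "T x = T y"
    then show "x = y"
      using e(2) [of "x - y"] e(1) by (simp add: diff mult_le_0_iff)
  qed
  have TI: "T (inv T x) = x" and IT: "inv T (T x) = x" for x
    using surj inj by (simp_all add: surj_f_inv_f)
  have "bounded_linear (inv T)"
  proof (rule bounded_linear_intro)
    show "inv T (x + y) = inv T x + inv T y" for x y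
      by (metis TI IT add)
    show "inv T (r *\<^sub>R x) = r *\<^sub>R inv T x" for r x
      by (metis TI IT scaleR)
    show "norm (inv T x) \<le> norm x * (1 / e)" for x
      using e(2) [of "inv T x"] e(1) by (simp add: TI field_simps)
  qed
  moreover have "inv T (c *\<^sub>C x) = c *\<^sub>C inv T x" for c x
    by (metis TI IT bounded_clinearD(2) [OF T(1)])
  ultimately have "bounded_clinear (inv T)"
    by (simp add: bounded_clinear_def)
  then show ?thesis
    unfolding invertible_op_def using T(1) TI IT by (intro conjI exI [of _ "inv T"]) (auto simp: fun_eq_iff)
qed

text \<open>For the symmetric operator \<open>A - p\<close>, being bounded below already gives
  invertibility, so a real spectral point is an approximate eigenvalue. This translates the
  inclusion of the spectra into the form used along orbits.\<close>

lemma op_spectrum_approximate_eigenvalue: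
  assumes A: "bounded_clinear A" "rsym A"
  shows "complex_of_real p \<in> op_spectrum A \<longleftrightarrow> approximate_eigenvalue A p"
proof -
  define T where "T x = A x - p *\<^sub>R x" for x
  have spec: "complex_of_real p \<in> op_spectrum A \<longleftrightarrow> \<not> invertible_op T"
    by (simp add: op_spectrum_def scaleC_of_real T_def [abs_def])
  have linT: "bounded_linear T"
    unfolding T_def by (intro bounded_linear_intros bounded_clinearD A)
  have clinT: "bounded_clinear T"
    unfolding bounded_clinear_def
  proof (intro conjI allI linT)
    fix c x
    interpret scaleC: additive "\<lambda>x. c *\<^sub>C (x :: 'a)"
      by standard (rule scaleC_add_right)
    show "T (c *\<^sub>C x) = c *\<^sub>C T x"
      by (simp add: T_def bounded_clinearD(2) [OF A(1)] scaleC.diff)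
        (simp add: scaleC_scaleC mult.commute flip: scaleC_of_real)
  qed
  have symT: "rsym T"
    by (simp add: T_def rsym_def rip_linear rsymD [OF A(2)])
  show ?thesis
  proof
    assume "complex_of_real p \<in> op_spectrum A"
    then have "\<not> invertible_op T"
      using spec by blast
    then have "\<not> (\<forall>x. e * norm x \<le> norm (T x))" if "e > 0" for e
      using rsym_bounded_below_invertible [OF clinT symT that] by blast
    then have "\<exists>u. norm (T u) < e * norm u" if "e > 0" for e
      using that by (auto simp: not_le)
    then show "approximate_eigenvalue A p"
      unfolding approximate_eigenvalue_def T_def
      by (metis less_imp_le mult_zero_right norm_not_less_zero norm_zero)
  next
    assume ae: "approximate_eigenvalue A p"
    have "\<not> invertible_op T"
    proof
      assume inv: "invertible_op T"
      have "bounded_linear (inv T)"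
        by (rule bounded_clinearD [OF invertible_op_inv(1) [OF inv]])
      then obtain K where K: "0 < K" "\<And>x. norm (inv T x) \<le> norm x * K"
        using bounded_linear.pos_bounded by blast
      obtain u where u: "u \<noteq> 0" "norm (T u) \<le> 1 / (2 * K) * norm u"
        using ae K(1) unfolding approximate_eigenvalue_def T_def
        by (metis zero_less_divide_1_iff mult_pos_pos zero_less_numeral)
      have "norm u = norm (inv T (T u))"
        using invertible_op_inv(3) [OF inv] by (simp add: fun_eq_iff)
      also have "\<dots> \<le> norm (T u) * K"
        by (rule K)
      also have "\<dots> \<le> (1 / (2 * K) * norm u) * K"
        using u(2) K(1) by (intro mult_right_mono) auto
      also have "\<dots> = norm u / 2"
        using K(1) by simp
      finally show False
        using u(1) by simp
    qed
    then show "complex_of_real p \<in> op_spectrum A"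
      using spec by blast
  qed
qed

subsection \<open>Adjoints and the inequality for equal operators\<close>

text \<open>The representing vector minimises \<open>\<parallel>x\<parallel>\<^sup>2 - 2 f x\<close>.\<close>

lemma rip_representation:
  fixes f :: "'a::complex_hilbert_space \<Rightarrow> real"
  assumes "bounded_linear f"
  obtains y where "\<And>x. f x = rip x y"
proof -
  interpret f: bounded_linear f by (rule assms)
  obtain K where K: "0 < K" "\<And>x. norm (f x) \<le> norm x * K"
    using f.pos_bounded by blast
  define J where "J x = (norm x)\<^sup>2 - 2 * f x" for x
  have lower: "- K\<^sup>2 \<le> J x" for x
  proof -
    have "f x \<le> norm x * K"
      using K(2) [of x] by simp
    then show ?thesis
      using zero_le_power2 [of "norm x - K"] by (simp add: J_def power2_diff)
  qed
  define \<mu> where "\<mu> = Inf (range J)"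
  have bdd: "bdd_below (range J)"
    using lower by (auto simp: bdd_below_def)
  have \<mu>: "\<mu> \<le> J x" for x
    unfolding \<mu>_def by (rule cINF_lower [OF bdd]) simp
  have "\<exists>x. J x < \<mu> + inverse (real (Suc n))" for n
    using cInf_lessD [of "range J" "\<mu> + inverse (real (Suc n))"] by (auto simp: \<mu>_def)
  then obtain X where X: "\<And>n. J (X n) < \<mu> + inverse (real (Suc n))"
    by metis
  \<comment> \<open>The parallelogram law, which makes a minimising sequence Cauchy.\<close>
  have par: "(norm (x - y))\<^sup>2 \<le> 2 * (J x - \<mu>) + 2 * (J y - \<mu>)" for x y
  proof -
    have "(norm (x - y))\<^sup>2 = 2 * J x + 2 * J y - 4 * J ((1 / 2) *\<^sub>R (x + y))"
      by (simp add: J_def norm_diff_sq norm_add_sq power_divide f.scaleR f.add rip_linear field_simps)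
    then show ?thesis
      using \<mu> [of "(1 / 2) *\<^sub>R (x + y)"] by simp
  qed
  have "Cauchy X"
  proof (rule metric_CauchyI)
    fix e :: real
    assume e: "e > 0"
    obtain N where N: "inverse (real (Suc N)) < e\<^sup>2 / 4"
      using reals_Archimedean [of "e\<^sup>2 / 4"] e by auto
    have "dist (X i) (X j) < e" if "i \<ge> N" "j \<ge> N" for i j
    proof -
      have small: "J (X k) - \<mu> < e\<^sup>2 / 4" if "k \<ge> N" for k
      proof -
        have "inverse (real (Suc k)) \<le> inverse (real (Suc N))"
          using that by (intro le_imp_inverse_le) auto
        then show ?thesis
          using X [of k] N by linarith
      qed
      have "(norm (X i - X j))\<^sup>2 < e\<^sup>2"
        using par [of "X i" "X j"] small [OF that(1)] small [OF that(2)] by argo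
      then show ?thesis
        using e by (simp add: dist_norm power2_less_imp_less)
    qed
    then show "\<exists>N. \<forall>i\<ge>N. \<forall>j\<ge>N. dist (X i) (X j) < e"
      by blast
  qed
  then obtain y where y: "X \<longlonglongrightarrow> y"
    using Cauchy_convergent_iff convergent_def by blast
  have "(\<lambda>n. J (X n)) \<longlonglongrightarrow> J y"
    unfolding J_def by (intro tendsto_intros y f.tendsto)
  moreover have "(\<lambda>n. \<mu> + inverse (real (Suc n))) \<longlonglongrightarrow> \<mu> + 0"
    by (intro tendsto_intros LIMSEQ_inverse_real_of_nat)
  ultimately have "J y \<le> \<mu> + 0"
    by (rule LIMSEQ_le) (use X less_imp_le in blast)
  have "f v = rip v y" for v
  proof -
    \<comment> \<open>\<open>a\<close> is half the derivative of \<open>J\<close> at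
      \<open>y\<close> in direction \<open>v\<close>, and \<open>a / s\<close> the test step; the
      added \<open>1\<close> keeps the division legitimate for \<open>v = 0\<close>.\<close>
    define a s where "a = rip y v - f v" and "s = (norm v)\<^sup>2 + 1"
    have s: "s > 0"
      by (simp add: s_def add_nonneg_pos)
    have expand: "J (y - t *\<^sub>R v) = J y - 2 * t * a + t\<^sup>2 * (s - 1)" for t
      by (simp add: J_def norm_diff_scaleR_sq f.diff f.scaleR a_def s_def algebra_simps)
    have "J y \<le> J (y - (a / s) *\<^sub>R v)"
      using \<open>J y \<le> \<mu> + 0\<close> \<mu> [of "y - (a / s) *\<^sub>R v"] by simp
    also have "\<dots> = J y - 2 * (a / s) * a + (a / s)\<^sup>2 * (s - 1)"
      by (rule expand)
    also have "\<dots> = J y - a\<^sup>2 / s - (a / s)\<^sup>2"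
      using s by (simp add: field_simps power2_eq_square)
    finally have "a\<^sup>2 / s + (a / s)\<^sup>2 \<le> 0"
      by simp
    moreover have "0 \<le> a\<^sup>2 / s"
      using s by simp
    ultimately have "(a / s)\<^sup>2 \<le> 0"
      by linarith
    then have "a = 0"
      using s by simp
    then show ?thesis
      by (simp add: a_def rip_commute)
  qed
  then show thesis
    by (rule that)
qed

lemma adjoint_exists:
  assumes "bounded_linear X"
  obtains Y where "\<And>x y. rip (X x) y = rip x (Y y)"
proof -
  have "\<exists>z. \<forall>x. rip (X x) y = rip x z" for y
  proof -
    interpret X: bounded_linear X by (rule assms)
    obtain K where K: "\<And>x. norm (X x) \<le> norm x * K"
      using X.bounded by blast
    have "bounded_linear (\<lambda>x. rip (X x) y)"
    proof (rule bounded_linear_intro)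
      show "norm (rip (X x) y) \<le> norm x * (K * norm y)" for x
        using rip_Cauchy_Schwarz [of "X x" y] mult_right_mono [OF K [of x] norm_ge_zero [of y]]
        by (simp add: mult.assoc)
    qed (simp_all add: X.add X.scaleR rip_linear)
    then show ?thesis
      using rip_representation by metis
  qed
  then show thesis
    using that by metis
qed

text \<open>The moments \<open>\<parallel>S\<^sup>n u\<parallel>\<close> are logarithmically convex.\<close>

lemma rsym_power_growth:
  assumes sym: "rsym S" and c: "c \<ge> 0" and bound: "\<And>n. norm ((S ^^ n) u) \<le> K * c ^ n"
  shows "norm (S u) \<le> c * norm u"
proof (cases "norm u = 0")
  case True
  have "norm ((S ^^ 2) u) * norm u = 0"
    using True by simp
  moreover have "(norm (S u))\<^sup>2 \<le> norm ((S ^^ 2) u) * norm u"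
    using rip_le_norms [of "S (S u)" u] by (simp add: numeral_2_eq_2 rsymD [OF sym, of "S u" u] rip_self)
  ultimately show ?thesis
    using True by simp
next
  case False
  show ?thesis
  proof (rule ccontr)
    assume neg: "\<not> ?thesis"
    define t where "t = norm (S u) / norm u"
    have ct: "c < t"
      using neg False by (simp add: t_def field_simps)
    have t: "t > 0"
      using ct c by simp
    \<comment> \<open>By logarithmic convexity the ratio of consecutive norms never drops below the
      first one, \<open>t\<close>.\<close>
    have grow: "0 < norm ((S ^^ n) u) \<and> t * norm ((S ^^ n) u) \<le> norm ((S ^^ Suc n) u)" for n
    proof (induction n)
      case 0
      then show ?case using False by (simp add: t_def)
    next
      case (Suc n)
      define a b d where "a = norm ((S ^^ n) u)" "b = norm ((S ^^ Suc n) u)" "d = norm ((S ^^ Suc (Suc n)) u)"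
      have ab: "0 < a" "t * a \<le> b"
        using Suc by (simp_all add: a_b_d_def)
      then have b: "0 < b"
        using t by (metis less_le_trans mult_pos_pos)
      have "b\<^sup>2 \<le> a * d"
        using rip_le_norms [of "(S ^^ n) u" "S (S ((S ^^ n) u))"]
        by (simp add: a_b_d_def rsymD [OF sym, of "(S ^^ n) u", symmetric] rip_self)
      then have "t * b * b \<le> t * a * d"
        using t by (simp add: power2_eq_square)
      also have "\<dots> \<le> b * d"
        using ab(2) by (intro mult_right_mono) (simp_all add: a_b_d_def)
      finally have "t * b \<le> d"
        using b by simp
      with b show ?case
        by (simp add: a_b_d_def)
    qed
    have "t ^ n * norm u \<le> norm ((S ^^ n) u)" for n
    proof (induction n)
      case (Suc n)
      then have "t * (t ^ n * norm u) \<le> t * norm ((S ^^ n) u)"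
        using t by (intro mult_left_mono) auto
      also have "\<dots> \<le> norm ((S ^^ Suc n) u)"
        using grow by blast
      finally show ?case by simp
    qed simp
    then have le: "t ^ n * norm u \<le> K * c ^ n" for n
      using bound order_trans by blast
    show False
    proof (cases "c = 0")
      case True
      then show False
        using le [of 1] t False by (simp add: mult_le_0_iff)
    next
      case c0: False
      have "(t / c) ^ n \<le> K / norm u" for n
        using le [of n] c c0 False by (simp add: power_divide field_simps)
      moreover obtain n where "K / norm u < (t / c) ^ n"
        using real_arch_pow [of "t / c"] ct c c0 by auto
      ultimately show False
        by (meson not_le)
    qed
  qed
qed

text \<open>With \<open>Y\<close> the adjoint of \<open>X\<close>, the operator \<open>Y X\<close> is similar to \<open>(P Y P\<^sup>-\<^sup>1) (P X P\<^sup>-\<^sup>1)\<close>.\<close>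

lemma onorm_similarity_sum_ge:
  assumes P: "bounded_linear P" "rsym P" and P': "bounded_linear P'" "\<And>x. P' (P x) = x" "\<And>x. P (P' x) = x"
    and X: "bounded_linear X"
  shows "2 * onorm X \<le> onorm (P \<circ> X \<circ> P') + onorm (P' \<circ> X \<circ> P)"
proof -
  obtain Y where Y: "\<And>x y. rip (X x) y = rip x (Y y)"
    using adjoint_exists [OF X] by blast
  have symPi: "rip (P' v) w = rip v (P' w)" for v w
    by (metis P'(3) P(2) rsymD)
  define a b where "a = onorm (P \<circ> X \<circ> P')" and "b = onorm (P' \<circ> X \<circ> P)"
  have lin: "bounded_linear (P \<circ> X \<circ> P')" "bounded_linear (P' \<circ> X \<circ> P)"
    unfolding o_def by (intro bounded_linear_compose [OF P(1)] bounded_linear_compose [OF P'(1)]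
        bounded_linear_compose [OF X] P(1) P'(1))+
  have a: "0 \<le> a" "norm (P (X (P' v))) \<le> a * norm v" and b: "0 \<le> b" "norm (P' (X (P v))) \<le> b * norm v" for v
    using onorm [OF lin(1), of v] onorm [OF lin(2), of v] onorm_pos_le [OF lin(1)] onorm_pos_le [OF lin(2)]
    by (simp_all add: a_def b_def)
  \<comment> \<open>\<open>P Y P'\<close> is the adjoint of \<open>P' X P\<close>, hence inherits
    the bound \<open>b\<close>.\<close>
  have G: "norm (P (Y (P' v))) \<le> b * norm v" for v
  proof -
    define g where "g = P (Y (P' v))"
    have "(norm g)\<^sup>2 = rip v (P' (X (P g)))"
      unfolding rip_self [symmetric] using Y symPi rsymD [OF P(2)] by (metis g_def rip_commute)
    also have "\<dots> \<le> norm v * (b * norm g)"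
      by (intro order_trans [OF rip_le_norms] mult_left_mono b) simp
    finally have "norm g * norm g \<le> (b * norm v) * norm g"
      by (simp add: power2_eq_square mult_ac)
    then show ?thesis
      using b(1) by (cases "norm g = 0") (simp_all add: g_def)
  qed
  define S where "S u = Y (X u)" for u
  have symS: "rsym S"
    unfolding rsym_def S_def using Y by (metis rip_commute)
  obtain K where K: "0 < K" "\<And>x. norm (P' x) \<le> norm x * K"
    using bounded_linear.pos_bounded [OF P'(1)] by blast
  have PS: "norm (P (S w)) \<le> (a * b) * norm (P w)" for w
  proof -
    have "norm (P (S w)) \<le> b * norm (P (X w))"
      using G [of "P (X w)"] by (simp add: S_def P'(2))
    also have "\<dots> \<le> b * (a * norm (P w))"
      using a(2) [of "P w"] b(1) by (intro mult_left_mono) (simp_all add: P'(2))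
    finally show ?thesis
      by (simp add: mult_ac)
  qed
  \<comment> \<open>Measured through \<open>P\<close>, the powers of \<open>S\<close> grow at most
    like \<open>(a * b) ^ n\<close>; going back costs only a constant factor, which
    \<open>rsym_power_growth\<close> absorbs.\<close>
  have Su: "norm (S u) \<le> (a * b) * norm u" for u
  proof (rule rsym_power_growth [OF symS])
    show "0 \<le> a * b"
      using a b by simp
    have pow: "norm (P ((S ^^ n) u)) \<le> (a * b) ^ n * norm (P u)" for n
    proof (induction n)
      case (Suc n)
      have "norm (P ((S ^^ Suc n) u)) \<le> (a * b) * norm (P ((S ^^ n) u))"
        using PS by simp
      also have "\<dots> \<le> (a * b) * ((a * b) ^ n * norm (P u))"
        using Suc a b by (intro mult_left_mono) auto
      finally show ?case by simp
    qed simp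
    show "norm ((S ^^ n) u) \<le> (norm (P u) * K) * (a * b) ^ n" for n
    proof -
      have "norm ((S ^^ n) u) \<le> norm (P ((S ^^ n) u)) * K"
        using K(2) [of "P ((S ^^ n) u)"] by (simp add: P'(2))
      also have "\<dots> \<le> ((a * b) ^ n * norm (P u)) * K"
        using pow K(1) by (intro mult_right_mono) auto
      finally show ?thesis
        by (simp add: mult_ac)
    qed
  qed
  have "onorm X \<le> sqrt (a * b)"
  proof (rule onorm_bound)
    fix u
    have "(norm (X u))\<^sup>2 = rip u (S u)"
      unfolding S_def by (simp add: rip_self flip: Y)
    also have "\<dots> \<le> norm u * ((a * b) * norm u)"
      by (intro order_trans [OF rip_le_norms] mult_left_mono Su) simp
    also have "\<dots> = (sqrt (a * b) * norm u)\<^sup>2"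
      using a(1) b(1) by (simp add: power_mult_distrib power2_eq_square [of "norm u"] mult_ac)
    finally show "norm (X u) \<le> sqrt (a * b) * norm u"
      by (rule power2_le_imp_le) (use a b in simp)
  qed (use a b in simp)
  also have "\<dots> \<le> (a + b) / 2"
    using a(1) b(1) by (rule arith_geo_mean_sqrt)
  finally show ?thesis
    by (simp add: a_def b_def)
qed

text \<open>For \<open>X = <., y> x\<close> and symmetric \<open>B\<close>, the operator
  \<open>A X B\<close> is \<open><., B y> A x\<close>, so its norm is at most
  \<open>norm (A x) * norm (B y)\<close>, while testing \<open>X\<close> at \<open>y\<close> shows
  that its own norm is at least \<open>norm x * norm y\<close>.\<close>

lemma rank_one_norm_inequality:
  assumes P: "bounded_clinear P" and P': "\<And>v w. cinner (P' v) w = cinner v (P' w)"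
    and Q': "bounded_clinear Q'" and Q: "\<And>v w. cinner (Q v) w = cinner v (Q w)"
    and ineq: "\<And>X. bounded_clinear X \<Longrightarrow> 2 * onorm X \<le> onorm (P \<circ> X \<circ> P') + onorm (Q' \<circ> X \<circ> Q)"
  shows "2 * norm x * norm y \<le> norm (P x) * norm (P' y) + norm (Q' x) * norm (Q y)"
proof -
  define X where "X v = cinner v y *\<^sub>C x" for v
  have scaleR: "cinner (r *\<^sub>R v) y = r * cinner v y" for r v
    by (simp add: scaleR_scaleC cinner_scaleC_left)
  have lin: "bounded_linear X"
  proof (rule bounded_linear_intro)
    show "norm (X v) \<le> norm v * (norm y * norm x)" for v
      using mult_right_mono [OF norm_cinner_le [of v y] norm_ge_zero [of x]]
      by (simp add: X_def norm_scaleC mult.assoc)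
  qed (simp_all add: X_def cinner_add_left scaleC_add_left scaleR scaleC_scaleC scaleR_scaleC cinner_scaleC_left)
  have clin: "bounded_clinear X"
    using lin by (simp add: bounded_clinear_def X_def cinner_scaleC_left scaleC_scaleC)
  have bound: "onorm (A \<circ> X \<circ> B) \<le> norm (A x) * norm (B y)"
    if A: "bounded_clinear A" and B: "\<And>v w. cinner (B v) w = cinner v (B w)" for A B :: "'a \<Rightarrow> 'a"
  proof (rule onorm_bound)
    fix v
    have "norm ((A \<circ> X \<circ> B) v) = cmod (cinner v (B y)) * norm (A x)"
      by (simp add: X_def bounded_clinearD(2) [OF A] norm_scaleC B)
    also have "\<dots> \<le> (norm v * norm (B y)) * norm (A x)"
      by (intro mult_right_mono norm_cinner_le) simp
    finally show "norm ((A \<circ> X \<circ> B) v) \<le> norm (A x) * norm (B y) * norm v"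
      by (simp add: mult_ac)
  qed simp
  have "norm x * norm y \<le> onorm X"
  proof (cases "y = 0")
    case True
    then show ?thesis
      using onorm_pos_le [OF lin] by simp
  next
    case False
    have "norm y * (norm x * norm y) = norm (X y)"
      unfolding X_def norm_scaleC cinner_self_norm norm_of_real by (simp add: power2_eq_square)
    also have "\<dots> \<le> norm y * onorm X"
      using onorm [OF lin, of y] by (simp add: mult.commute)
    finally show ?thesis
      using False by simp
  qed
  then show ?thesis
    using ineq [OF clin] bound [OF P P'] bound [OF Q' Q] by simp
qed

theorem lemma5:
  fixes P Q :: "'h::complex_hilbert_space \<Rightarrow> 'h"
  assumes separable: "separable_space (euclidean :: 'h topology)"
    and P: "positive_op P" "invertible_op P"
    and Q: "positive_op Q" "invertible_op Q"
    and spectra: "op_spectrum Q \<subseteq> op_spectrum P \<or> op_spectrum P \<subseteq> op_spectrum Q"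
  shows "(\<forall>X. bounded_clinear X \<longrightarrow>
            onorm (P \<circ> X \<circ> inv P) + onorm (inv Q \<circ> X \<circ> Q) \<ge> 2 * onorm X)
         \<longleftrightarrow> P = Q"
proof -
  have inverse: "inv A (A x) = x" "A (inv A x) = x" if "invertible_op A" for A :: "'h \<Rightarrow> 'h" and x
    using invertible_op_inv(2,3) [OF that] by (simp_all add: fun_eq_iff)
  have coercive: "\<exists>m>0. \<forall>x. m * (norm x)\<^sup>2 \<le> rip (A x) x" if A: "positive_op A" "invertible_op A" for A :: "'h \<Rightarrow> 'h"
  proof -
    obtain K where K: "0 < K" "\<And>x. norm (inv A x) \<le> norm x * K"
      using bounded_linear.pos_bounded [OF bounded_clinearD(1) [OF invertible_op_inv(1) [OF A(2)]]] by blast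
    have "norm x \<le> K * norm (A x)" for x
      using K(2) [of "A x"] by (simp add: inverse(1) [OF A(2)] mult.commute)
    then show ?thesis
      using positive_coercive [OF bounded_clinearD(1) [OF positive_opD(1)] positive_opD(2,3), OF A(1) A(1) A(1) K(1)]
      by metis
  qed
  note clinP = positive_opD(1) [OF P(1)] and clinQ = positive_opD(1) [OF Q(1)]
  note clinPi = invertible_op_inv(1) [OF P(2)] and clinQi = invertible_op_inv(1) [OF Q(2)]
  show ?thesis
  proof
    assume ineq: "\<forall>X. bounded_clinear X \<longrightarrow> onorm (P \<circ> X \<circ> inv P) + onorm (inv Q \<circ> X \<circ> Q) \<ge> 2 * onorm X"
    have symPi: "cinner (inv P v) w = cinner v (inv P w)" for v w
      using positive_op_cinner_sym [OF P(1), of "inv P v" "inv P w"] by (simp add: inverse [OF P(2)])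
    have rank_one: "2 * norm x * norm y \<le> norm (P x) * norm (inv P y) + norm (inv Q x) * norm (Q y)" for x y
      by (rule rank_one_norm_inequality [OF clinP symPi clinQi positive_op_cinner_sym [OF Q(1)]])
        (use ineq in blast)
    obtain m1 m2 where m1: "m1 > 0" "\<And>x. m1 * (norm x)\<^sup>2 \<le> rip (P x) x"
      and m2: "m2 > 0" "\<And>x. m2 * (norm x)\<^sup>2 \<le> rip (Q x) x"
      using coercive [OF P] coercive [OF Q] by blast
    have m: "min m1 m2 > 0" "min m1 m2 * (norm x)\<^sup>2 \<le> rip (P x) x" "min m1 m2 * (norm x)\<^sup>2 \<le> rip (Q x) x" for x
      using m1(1) m2(1) order_trans [OF mult_right_mono [OF min.cobounded1 zero_le_power2] m1(2)]
        order_trans [OF mult_right_mono [OF min.cobounded2 zero_le_power2] m2(2)]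
      by auto
    \<comment> \<open>The inclusion of the spectra is read off at real points, where spectral points
      and approximate eigenvalues agree.\<close>
    have "(\<forall>p. approximate_eigenvalue Q p \<longrightarrow> approximate_eigenvalue P p)
        \<or> (\<forall>p. approximate_eigenvalue P p \<longrightarrow> approximate_eigenvalue Q p)"
      using spectra op_spectrum_approximate_eigenvalue [OF clinP positive_opD(2) [OF P(1)]]
        op_spectrum_approximate_eigenvalue [OF clinQ positive_opD(2) [OF Q(1)]] by blast
    then show "P = Q"
      by (rule eq_of_spectra [OF bounded_clinearD(1) [OF clinP] positive_opD(2) [OF P(1)]
            bounded_clinearD(1) [OF clinQ] positive_opD(2) [OF Q(1)]
            bounded_clinearD(1) [OF clinPi] inverse(1) [OF P(2)]
            bounded_clinearD(1) [OF clinQi] inverse [OF Q(2)] m rank_one])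
  next
    assume "P = Q"
    then show "\<forall>X. bounded_clinear X \<longrightarrow> onorm (P \<circ> X \<circ> inv P) + onorm (inv Q \<circ> X \<circ> Q) \<ge> 2 * onorm X"
      using onorm_similarity_sum_ge [OF bounded_clinearD(1) [OF clinQ] positive_opD(2) [OF Q(1)]
          bounded_clinearD(1) [OF clinQi] inverse [OF Q(2)]] bounded_clinearD(1) by blast
  qed
qed

end
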